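(* Let $P$ be an interval poset, and let $\sigma$ be any permutation such that $P(\sigma)=P$. Then a permutation $\tau$ is a generator of $P$ if and only if $sk(T(\tau^{-1}))=sk(T(\sigma^{-1}))$.
   Context: A permutation $\sigma=\sigma(1)\dots\sigma(n)$ of size $n$ is a word on $\{1,\dots,n\}$ containing each letter exactly once. A non-empty interval of $\sigma$ is a set of values $[j,j+h]=\{j,\dots,j+h\}$ such that $\{\sigma(i),\dots,\sigma(i+h)\}=[j,j+h]$ for some $i$. $P(\sigma)$ is the poset of all non-empty intervals of $\sigma$ (including singletons and $[1,n]$) ordered by inclusion. An interval poset is a poset of the form $P(\sigma)$; equality of interval posets means equality as sets of intervals ordered by inclusion (not merely isomorphism). A generator of an interval poset $P$ is a permutation $\tau$ such that $P(\tau)=P$. A permutation is simple if it has size at least $4$ and its only non-empty intervals are the singletons and $[1,n]$. For $\pi$ of size $k$ and permutations $\alpha_1,\dots,\alpha_k$, the inflation $\pi[\alpha_1,\dots,\alpha_k]$ is the permutation obtained from $\pi$ by replacing each $\pi(i)$ by a block $I_i$ of consecutive positions whose values form an interval, such that all elements of $I_i$ are larger than all elements of $I_j$ whenever $\pi(i)>\pi(j)$, and the elements of $I_i$ form a sequence order-isomorphic to $\alpha_i$. Write $\oplus[\alpha_1,\dots,\alpha_k]$ (resp. $\ominus[\alpha_1,\dots,\alpha_k]$) when $\pi=12\dots k$ (resp. $\pi=k\dots21$), $k\ge2$. A permutation is $\oplus$-indecomposable (resp. $\ominus$-indecomposable) if it is not of the form $\oplus[\alpha_1,\dots,\alpha_k]$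 (resp. $\ominus[\alpha_1,\dots,\alpha_k]$) with $k\ge 2$. Every permutation of size at least $2$ can be uniquely written as $\pi[\alpha_1,\dots,\alpha_k]$ (its substitution decomposition) with either $\pi$ simple; or $\pi=12\dots k$, $k\ge2$, and all $\alpha_i$ $\oplus$-indecomposable; or $\pi=k\dots21$, $k\ge 2$, and all $\alpha_i$ $\ominus$-indecomposable. The decomposition tree $T(\sigma)$ is the rooted plane tree defined recursively: it is a single leaf if $\sigma=1$; otherwise, with $\sigma=\pi[\alpha_1,\dots,\alpha_k]$ the substitution decomposition, its root is labeled by $\pi$ if $\pi$ is simple, by $\oplus$ if $\pi=12\dots k$, by $\ominus$ if $\pi=k\dots 21$, and the subtrees of the root are, from left to right, $T(\alpha_1),\dots,T(\alpha_k)$. The skeleton $sk(T)$ of a decomposition tree $T$ is the copy of $T$ (as a rooted plane tree) in which each internal node is relabeled as prime if its label in $T$ is a simple permutation, and as linear if its label in $T$ is $\oplus$ or $\ominus$. *)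

theory Defs
  imports "HOL-Combinatorics.Multiset_Permutations"
begin

text \<open>
  A permutation of size \<open>n \<ge> 1\<close> is the word \<open>\<sigma>(1) \<dots> \<sigma>(n)\<close>, a list over \<open>{1..n}\<close>. Values are
  counted from 1, whereas list positions are counted from 0, so \<open>\<sigma>(i + 1)\<close> is \<open>\<sigma> ! i\<close>.
\<close>

definition is_perm :: "nat list \<Rightarrow> bool" where
  "is_perm \<sigma> \<longleftrightarrow> \<sigma> \<noteq> [] \<and> \<sigma> \<in> permutations_of_set {1..length \<sigma>}"

definition perm_inverse :: "nat list \<Rightarrow> nat list" where
  "perm_inverse \<sigma> = map (\<lambda>v. Suc (inv_into {..<length \<sigma>} ((!) \<sigma>) v)) [1..<Suc (length \<sigma>)]"

definition intervals :: "nat list \<Rightarrow> nat set set" where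
  "intervals \<sigma> = {{j..j + h} | j h. \<exists>i. i + h < length \<sigma> \<and> (!) \<sigma> ` {i..i + h} = {j..j + h}}"

text \<open>A poset is given by its carrier together with its order relation.\<close>

type_synonym poset = "nat set set \<times> nat set rel"

definition interval_poset :: "nat list \<Rightarrow> poset" where
  "interval_poset \<sigma> = (intervals \<sigma>, relation_of (\<subseteq>) (intervals \<sigma>))"

definition is_interval_poset :: "poset \<Rightarrow> bool" where
  "is_interval_poset P \<longleftrightarrow> (\<exists>\<sigma>. is_perm \<sigma> \<and> P = interval_poset \<sigma>)"

definition is_generator :: "nat list \<Rightarrow> poset \<Rightarrow> bool" where
  "is_generator \<tau> P \<longleftrightarrow> is_perm \<tau> \<and> interval_poset \<tau> = P"

definition simple_perm :: "nat list \<Rightarrow> bool" where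
  "simple_perm \<pi> \<longleftrightarrow> is_perm \<pi> \<and> length \<pi> \<ge> 4 \<and>
     (\<forall>I \<in> intervals \<pi>. (\<exists>v. I = {v}) \<or> I = {1..length \<pi>})"

text \<open>
  In \<open>\<pi>[\<alpha>\<^sub>1, \<dots>, \<alpha>\<^sub>k]\<close> the \<open>i\<close>-th block is \<open>\<alpha>\<^sub>i\<close> shifted by the total size of the blocks that have to
  lie below it, namely those \<open>\<alpha>\<^sub>j\<close> with \<open>\<pi>(j) < \<pi>(i)\<close>. Only meaningful if \<open>\<pi>\<close> has size \<open>k\<close>.
\<close>

definition inflation :: "nat list \<Rightarrow> nat list list \<Rightarrow> nat list" where
  "inflation \<pi> \<alpha>s = concat (map (\<lambda>i.
     map (\<lambda>x. x + (\<Sum>j | j < length \<pi> \<and> \<pi> ! j < \<pi> ! i. length (\<alpha>s ! j))) (\<alpha>s ! i)) [0..<length \<pi>])"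

definition increasing_perm :: "nat \<Rightarrow> nat list" where
  "increasing_perm k = [1..<Suc k]"

definition decreasing_perm :: "nat \<Rightarrow> nat list" where
  "decreasing_perm k = rev [1..<Suc k]"

definition plus_indecomposable :: "nat list \<Rightarrow> bool" where
  "plus_indecomposable \<sigma> \<longleftrightarrow>
     \<not> (\<exists>\<alpha>s. length \<alpha>s \<ge> 2 \<and> (\<forall>\<alpha> \<in> set \<alpha>s. is_perm \<alpha>) \<and>
            \<sigma> = inflation (increasing_perm (length \<alpha>s)) \<alpha>s)"

definition minus_indecomposable :: "nat list \<Rightarrow> bool" where
  "minus_indecomposable \<sigma> \<longleftrightarrow>
     \<not> (\<exists>\<alpha>s. length \<alpha>s \<ge> 2 \<and> (\<forall>\<alpha> \<in> set \<alpha>s. is_perm \<alpha>) \<and>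
            \<sigma> = inflation (decreasing_perm (length \<alpha>s)) \<alpha>s)"

definition substitution_decomposition :: "nat list \<Rightarrow> nat list \<Rightarrow> nat list list \<Rightarrow> bool" where
  "substitution_decomposition \<sigma> \<pi> \<alpha>s \<longleftrightarrow>
     length \<alpha>s = length \<pi> \<and> (\<forall>\<alpha> \<in> set \<alpha>s. is_perm \<alpha>) \<and> \<sigma> = inflation \<pi> \<alpha>s \<and>
     (simple_perm \<pi> \<or>
      (\<exists>k \<ge> 2. \<pi> = increasing_perm k \<and> (\<forall>\<alpha> \<in> set \<alpha>s. plus_indecomposable \<alpha>)) \<or>
      (\<exists>k \<ge> 2. \<pi> = decreasing_perm k \<and> (\<forall>\<alpha> \<in> set \<alpha>s. minus_indecomposable \<alpha>)))"

datatype 'l plane_tree = Leaf | Node 'l "'l plane_tree list"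

datatype label = Simple "nat list" | Plus | Minus

definition root_label :: "nat list \<Rightarrow> label" where
  "root_label \<pi> =
     (if simple_perm \<pi> then Simple \<pi>
      else if \<pi> = increasing_perm (length \<pi>) then Plus
      else Minus)"

text \<open>
  The recursive definition of the decomposition tree is stated as an inductive relation, and the tree
  is the unique one it relates to \<open>\<sigma>\<close>; for a permutation it exists and is unique because the
  substitution decomposition exists and is unique for every permutation of size at least 2.
\<close>

inductive is_decomposition_tree :: "nat list \<Rightarrow> label plane_tree \<Rightarrow> bool" where
  leaf: "is_decomposition_tree [1] Leaf"
| node: "substitution_decomposition \<sigma> \<pi> \<alpha>s \<Longrightarrow> list_all2 is_decomposition_tree \<alpha>s ts \<Longrightarrow>
         is_decomposition_tree \<sigma> (Node (root_label \<pi>) ts)"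

definition decomposition_tree :: "nat list \<Rightarrow> label plane_tree" where
  "decomposition_tree \<sigma> = (THE t. is_decomposition_tree \<sigma> t)"

datatype node_kind = Prime | Linear

fun kind_of_label :: "label \<Rightarrow> node_kind" where
  "kind_of_label (Simple \<pi>) = Prime"
| "kind_of_label Plus = Linear"
| "kind_of_label Minus = Linear"

definition skeleton :: "label plane_tree \<Rightarrow> node_kind plane_tree" where
  "skeleton T = map_plane_tree kind_of_label T"

end

theory Submission
  imports Defs
begin

text \<open>
  The intervals of \<open>\<sigma>\<close> are sets of values occupying consecutive positions. Passing to the inverse
  exchanges values and positions: an interval \<open>{a + 1..b}\<close> of \<open>\<sigma>\<close> is the same thing as a window \<open>[a, b)\<close>
  of positions of \<open>\<rho> = \<sigma>\<^sup>-\<^sup>1\<close> whose entries form a convex set of values, called a block of \<open>\<rho>\<close> below.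
  So the theorem says that two permutations have the same blocks exactly when their decomposition
  trees have the same skeleton, and this splits into two statements.

  The skeleton determines the blocks (\<open>block_eq_tree_block\<close>). Each node of the tree occupies a window
  of positions, whose bounds are given by counting leaves. Besides the single positions, the blocks
  are the windows of the nodes and the unions of consecutive children of linear nodes. Indeed, a
  block that meets several children of a node and cuts one of them in two would, under a linear node,
  split this child in the forbidden direction (\<open>monotone_block_across\<close>); under a prime node it induces
  an interval of the simple label, hence meets all children, and if it missed a position of the first
  or the last child, then the remaining children would give a nontrivial interval of the label
  (\<open>simple_block_across\<close>).

  The blocks determine the skeleton (\<open>tree_block_inj\<close>). The windows of the children of the root are
  the maximal ones among the proper blocks overlapped by no other block, because a union of at least
  two but not all children of a linear node is overlapped by another such union. Hence the block
  system determines the children and, recursively, their subtrees. The root is linear if and only if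
  it has two children or its first two children together form a block, since a prime node has at
  least four children.

  As \<open>decomposition_tree\<close> is a definite description, existence and uniqueness of the tree are needed
  too. Uniqueness is a byproduct: two trees of one permutation have the same skeleton, hence the same
  window of positions for each child, and both the pattern and the components of an inflation can be
  read off the order of the entries once the windows are known. For existence
  (\<open>decomposition_tree_exists\<close>), a permutation that splits into lower and upper (or upper and lower)
  part at some position is decomposed at all such positions; any other permutation is decomposed
  into its maximal proper blocks, and its pattern is then simple.
\<close>

section \<open>Permutations and the order of their entries\<close>

lemma is_perm_iff: "is_perm w \<longleftrightarrow> w \<noteq> [] \<and> distinct w \<and> set w = {1..length w}"
  by (auto simp: is_perm_def permutations_of_set_def)

lemma perm_nth_eq_rank:
  assumes "is_perm u" "p < length u"
  shows "u ! p = Suc (card {q. q < length u \<and> u ! q < u ! p})"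
proof -
  have u: "distinct u" "set u = {1..length u}"
    using assms by (auto simp: is_perm_iff)
  have bound: "1 \<le> u ! p" "u ! p \<le> length u"
    using u(2) nth_mem[OF assms(2)] by auto
  have "(!) u ` {q. q < length u \<and> u ! q < u ! p} = {x \<in> set u. x < u ! p}"
    by (auto simp: set_conv_nth)
  also have "\<dots> = {1..<u ! p}"
    using bound by (auto simp: u(2))
  finally have "card ((!) u ` {q. q < length u \<and> u ! q < u ! p}) = u ! p - 1"
    by simp
  moreover have "inj_on ((!) u) {q. q < length u \<and> u ! q < u ! p}"
    using u(1) by (auto simp: inj_on_def nth_eq_iff_index_eq)
  ultimately show ?thesis
    using bound by (simp add: card_image)
qed

text \<open>
  The entries of a permutation are the ranks of its positions, so comparing entries suffices to
  identify a permutation; the values in an inflation are computed only once, to see how they compare.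
\<close>

lemma perm_eqI:
  assumes "is_perm u" "is_perm v" "length u = length v"
    and "\<And>p q. p < length u \<Longrightarrow> q < length u \<Longrightarrow> u ! p < u ! q \<longleftrightarrow> v ! p < v ! q"
  shows "u = v"
proof (rule nth_equalityI)
  fix p assume p: "p < length u"
  have "{q. q < length u \<and> u ! q < u ! p} = {q. q < length v \<and> v ! q < v ! p}"
    using assms p by auto
  then show "u ! p = v ! p"
    using perm_nth_eq_rank[OF assms(1) p] perm_nth_eq_rank[OF assms(2), of p] p assms(3) by simp
qed fact

text \<open>
  The permutation order-isomorphic to a word with distinct letters.
\<close>

definition standardize :: "nat list \<Rightarrow> nat list" where
  "standardize w = map (\<lambda>x. card {y \<in> set w. y \<le> x}) w"

lemma length_standardize [simp]: "length (standardize w) = length w"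
  by (simp add: standardize_def)

lemma card_le_less_iff:
  assumes "x \<in> set w" "y \<in> set w"
  shows "card {z \<in> set w. z \<le> x} < card {z \<in> set w. z \<le> (y :: nat)} \<longleftrightarrow> x < y"
proof
  assume "x < y"
  then have "{z \<in> set w. z \<le> x} \<subseteq> {z \<in> set w. z \<le> y}"
    and "y \<in> {z \<in> set w. z \<le> y}" "y \<notin> {z \<in> set w. z \<le> x}"
    using assms by auto
  then have "{z \<in> set w. z \<le> x} \<subset> {z \<in> set w. z \<le> y}"
    by blast
  then show "card {z \<in> set w. z \<le> x} < card {z \<in> set w. z \<le> y}"
    by (intro psubset_card_mono) auto
next
  assume "card {z \<in> set w. z \<le> x} < card {z \<in> set w. z \<le> y}"
  moreover have "card {z \<in> set w. z \<le> y} \<le> card {z \<in> set w. z \<le> x}" if "y \<le> x"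
    using that by (intro card_mono) auto
  ultimately show "x < y"
    by (meson not_le)
qed

lemma standardize_less_iff:
  "p < length w \<Longrightarrow> q < length w \<Longrightarrow> standardize w ! p < standardize w ! q \<longleftrightarrow> w ! p < w ! q"
  by (simp add: standardize_def card_le_less_iff)

lemma distinct_bounded_is_perm:
  assumes "w \<noteq> []" "distinct w" "set w \<subseteq> {1..length w}"
  shows "is_perm w"
proof -
  have "set w = {1..length w}"
    by (rule card_subset_eq) (use assms in \<open>auto simp: distinct_card\<close>)
  with assms show ?thesis by (simp add: is_perm_iff)
qed

lemma is_perm_standardize:
  assumes "w \<noteq> []" "distinct w"
  shows "is_perm (standardize w)"
proof (rule distinct_bounded_is_perm)
  show "standardize w \<noteq> []"
    using assms by (simp add: standardize_def)
  show "distinct (standardize w)"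
    unfolding distinct_conv_nth
    using assms by (metis distinct_conv_nth length_standardize less_irrefl linorder_neqE_nat standardize_less_iff)
  have "1 \<le> card {y \<in> set w. y \<le> x} \<and> card {y \<in> set w. y \<le> x} \<le> length w" if "x \<in> set w" for x
  proof
    have "{x} \<subseteq> {y \<in> set w. y \<le> x}" using that by auto
    from card_mono[OF _ this] show "1 \<le> card {y \<in> set w. y \<le> x}" by simp
    have "card {y \<in> set w. y \<le> x} \<le> card (set w)" by (intro card_mono) auto
    then show "card {y \<in> set w. y \<le> x} \<le> length w"
      using card_length le_trans by blast
  qed
  then show "set (standardize w) \<subseteq> {1..length (standardize w)}"
    by (auto simp: standardize_def)
qed

section \<open>Cutting a list of lengths into windows\<close>

text \<open>
  If a word is cut into windows of lengths \<open>ns\<close>, the \<open>i\<close>-th window is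
  \<open>[offset ns i, offset ns (i + 1))\<close>.
\<close>

definition offset :: "nat list \<Rightarrow> nat \<Rightarrow> nat" where
  "offset ns i = sum_list (take i ns)"

lemma offset_0 [simp]: "offset ns 0 = 0"
  by (simp add: offset_def)

lemma offset_length [simp]: "offset ns (length ns) = sum_list ns"
  by (simp add: offset_def)

lemma offset_Suc: "i < length ns \<Longrightarrow> offset ns (Suc i) = offset ns i + ns ! i"
  by (simp add: offset_def take_Suc_conv_app_nth)

lemma offset_mono: "i \<le> j \<Longrightarrow> offset ns i \<le> offset ns j"
  unfolding offset_def by (metis le_Suc_ex le_add1 sum_list_append take_add)

lemma offset_le: "offset ns i \<le> sum_list ns"
  unfolding offset_def by (metis append_take_drop_id le_add1 sum_list_append)

lemma offset_add_less: "i < j \<Longrightarrow> i < length ns \<Longrightarrow> p < ns ! i \<Longrightarrow> offset ns i + p < offset ns j"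
  using offset_mono[of "Suc i" j ns] offset_Suc[of i ns] by linarith

lemma offset_strict_mono:
  "i < j \<Longrightarrow> j \<le> length ns \<Longrightarrow> (\<And>n. n \<in> set ns \<Longrightarrow> 0 < n) \<Longrightarrow> offset ns i < offset ns j"
  using offset_add_less[of i j ns 0] by (simp add: nth_mem)

lemma offset_locate:
  "r < sum_list ns \<Longrightarrow> \<exists>i < length ns. \<exists>p < ns ! i. r = offset ns i + p"
proof (induction ns arbitrary: r)
  case (Cons n ns)
  show ?case
  proof (cases "r < n")
    case True
    then show ?thesis by (intro exI[of _ 0]) simp
  next
    case False
    with Cons.prems have "r - n < sum_list ns" by simp
    from Cons.IH[OF this] obtain i p where "i < length ns" "p < ns ! i" "r - n = offset ns i + p"
      by blast
    with False show ?thesis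
      by (intro exI[of _ "Suc i"]) (auto simp: offset_def)
  qed
qed simp

lemma nth_concat_offset:
  "i < length xss \<Longrightarrow> p < length (xss ! i) \<Longrightarrow>
     concat xss ! (offset (map length xss) i + p) = xss ! i ! p"
proof (induction xss arbitrary: i)
  case (Cons xs xss)
  then show ?case
    by (cases i) (auto simp: offset_def nth_append)
qed simp

text \<open>
  Lets a decomposition be specified by the set of positions at which to cut.
\<close>

lemma finite_set_as_offsets:
  assumes "0 \<in> M" "n \<in> M" "M \<subseteq> {..n}"
  obtains ns where "\<And>x. x \<in> set ns \<Longrightarrow> 0 < x" "sum_list ns = n" "M = offset ns ` {..length ns}"
proof -
  have fin: "finite M" using assms(3) finite_subset by blast
  define xs where "xs = sorted_list_of_set M"
  define ns where "ns = map (\<lambda>i. xs ! Suc i - xs ! i) [0..<length xs - 1]"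
  have set_xs: "set xs = M" and srt: "sorted_wrt (<) xs"
    using fin by (simp_all add: xs_def)
  have ne: "xs \<noteq> []" using set_xs assms(1) by auto
  have less: "xs ! i < xs ! j" if "i < j" "j < length xs" for i j
    using srt that by (simp add: sorted_wrt_iff_nth_less)
  have mono: "xs ! i \<le> xs ! j" if "i \<le> j" "j < length xs" for i j
    using less[of i j] that by (cases "i = j") auto
  have x0: "xs ! 0 = 0"
  proof -
    obtain i where "i < length xs" "xs ! i = 0"
      using assms(1) set_xs by (metis in_set_conv_nth)
    then show ?thesis using mono[of 0 i] by simp
  qed
  have xl: "xs ! (length xs - 1) = n"
  proof -
    obtain i where i: "i < length xs" "xs ! i = n"
      using assms(2) set_xs by (metis in_set_conv_nth)
    have "xs ! (length xs - 1) \<in> M"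
      using set_xs ne nth_mem[of "length xs - 1" xs] by simp
    then have "xs ! (length xs - 1) \<le> n" using assms(3) by auto
    with i show ?thesis using mono[of i "length xs - 1"] by simp
  qed
  have off: "offset ns i = xs ! i" if "i < length xs" for i
    using that
  proof (induction i)
    case (Suc i)
    then have "i < length xs - 1" by simp
    then have "i < length ns" "ns ! i = xs ! Suc i - xs ! i"
      by (simp_all add: ns_def)
    with Suc show ?case
      using less[of i "Suc i"] by (simp add: offset_Suc)
  qed (simp add: x0)
  have len: "length xs = Suc (length ns)" using ne by (simp add: ns_def)
  show thesis
  proof
    show "0 < x" if "x \<in> set ns" for x
      using that less by (force simp: ns_def)
    show "sum_list ns = n"
      using off[of "length ns"] xl len by simp
    have "M = (!) xs ` {..<length xs}"
      using set_xs by (auto simp: set_conv_nth)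
    also have "\<dots> = offset ns ` {..length ns}"
      using off len by (auto simp: image_iff lessThan_Suc_atMost)
    finally show "M = offset ns ` {..length ns}" .
  qed
qed

section \<open>Inflations in terms of the order of entries\<close>

text \<open>
  What the word \<open>w = \<pi>[\<alpha>\<^sub>1, \<dots>, \<alpha>\<^sub>k]\<close> looks like if only comparisons of entries are observed. Entries
  in different windows compare as the letters of \<open>\<pi>\<close>, entries in the same window as those of the
  component. For permutations this is equivalent to being the inflation.
\<close>

locale inflated =
  fixes w \<pi> :: "nat list" and \<alpha>s :: "nat list list"
  assumes length_parts: "length \<alpha>s = length \<pi>"
    and length_word: "length w = sum_list (map length \<alpha>s)"
    and parts_nonempty: "\<And>i. i < length \<pi> \<Longrightarrow> 0 < length (\<alpha>s ! i)"
    and parts_distinct: "\<And>i. i < length \<pi> \<Longrightarrow> distinct (\<alpha>s ! i)"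
    and pattern_distinct: "distinct \<pi>"
    and less_iff: "\<And>i j p q. i < length \<pi> \<Longrightarrow> j < length \<pi> \<Longrightarrow>
       p < length (\<alpha>s ! i) \<Longrightarrow> q < length (\<alpha>s ! j) \<Longrightarrow>
       w ! (offset (map length \<alpha>s) i + p) < w ! (offset (map length \<alpha>s) j + q) \<longleftrightarrow>
         (if i = j then \<alpha>s ! i ! p < \<alpha>s ! i ! q else \<pi> ! i < \<pi> ! j)"
begin

abbreviation off :: "nat \<Rightarrow> nat" where
  "off \<equiv> offset (map length \<alpha>s)"

lemma off_end: "off (length \<pi>) = length w"
  using offset_length[of "map length \<alpha>s"] by (simp add: length_parts length_word)

lemma off_Suc: "i < length \<pi> \<Longrightarrow> off (Suc i) = off i + length (\<alpha>s ! i)"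
  by (simp add: offset_Suc length_parts)

lemma off_add_less: "i < j \<Longrightarrow> i < length \<pi> \<Longrightarrow> p < length (\<alpha>s ! i) \<Longrightarrow> off i + p < off j"
  by (simp add: offset_add_less length_parts)

lemma off_strict_mono: "i < j \<Longrightarrow> j \<le> length \<pi> \<Longrightarrow> off i < off j"
  using off_add_less[of i j 0] parts_nonempty[of i] by simp

lemma off_le: "off i \<le> length w"
  by (simp add: offset_le length_word)

lemma locate:
  assumes "r < length w"
  obtains i p where "i < length \<pi>" "p < length (\<alpha>s ! i)" "r = off i + p"
  using offset_locate[of r "map length \<alpha>s"] assms by (auto simp: length_word length_parts)

lemma position_less: "i < length \<pi> \<Longrightarrow> p < length (\<alpha>s ! i) \<Longrightarrow> off i + p < length w"
  using off_add_less[of i "length \<pi>" p] by (simp add: off_end)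

lemma less_across_iff:
  "i < length \<pi> \<Longrightarrow> j < length \<pi> \<Longrightarrow> p < length (\<alpha>s ! i) \<Longrightarrow> q < length (\<alpha>s ! j) \<Longrightarrow> i \<noteq> j \<Longrightarrow>
    w ! (off i + p) < w ! (off j + q) \<longleftrightarrow> \<pi> ! i < \<pi> ! j"
  by (simp add: less_iff)

lemma less_within_iff:
  "i < length \<pi> \<Longrightarrow> p < length (\<alpha>s ! i) \<Longrightarrow> q < length (\<alpha>s ! i) \<Longrightarrow>
    w ! (off i + p) < w ! (off i + q) \<longleftrightarrow> \<alpha>s ! i ! p < \<alpha>s ! i ! q"
  by (simp add: less_iff)

lemma word_distinct: "distinct w"
  unfolding distinct_conv_nth
proof (intro allI impI)
  fix r s assume rs: "r < length w" "s < length w" "r \<noteq> s"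
  obtain i p where r: "i < length \<pi>" "p < length (\<alpha>s ! i)" "r = off i + p"
    using locate[OF rs(1)] by blast
  obtain j q where s: "j < length \<pi>" "q < length (\<alpha>s ! j)" "s = off j + q"
    using locate[OF rs(2)] by blast
  have "w ! r < w ! s \<or> w ! s < w ! r"
  proof (cases "i = j")
    case True
    with rs r s have "p \<noteq> q" by auto
    then have "\<alpha>s ! i ! p \<noteq> \<alpha>s ! i ! q"
      using r s True parts_distinct by (simp add: nth_eq_iff_index_eq)
    then show ?thesis
      using r s True less_within_iff[of i p q] less_within_iff[of i q p] by auto
  next
    case False
    then have "\<pi> ! i \<noteq> \<pi> ! j"
      using r s pattern_distinct by (simp add: nth_eq_iff_index_eq)
    then show ?thesis
      using r s False less_across_iff[of i j p q] less_across_iff[of j i q p] by auto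
  qed
  then show "w ! r \<noteq> w ! s" by auto
qed

end

text \<open>
  The left-hand side bounds the entries of the \<open>i\<close>-th block and the right-hand side is the shift of
  the \<open>j\<close>-th, so the former block lies entirely below the latter.
\<close>

lemma inflation_shift_mono:
  fixes \<pi> :: "nat list"
  assumes "i < length \<pi>" "\<pi> ! i < \<pi> ! j"
  shows "(\<Sum>l | l < length \<pi> \<and> \<pi> ! l < \<pi> ! i. length (\<alpha>s ! l)) + length (\<alpha>s ! i)
    \<le> (\<Sum>l | l < length \<pi> \<and> \<pi> ! l < \<pi> ! j. length (\<alpha>s ! l))"
proof -
  have "(\<Sum>l | l < length \<pi> \<and> \<pi> ! l < \<pi> ! i. length (\<alpha>s ! l)) + length (\<alpha>s ! i)
      = (\<Sum>l \<in> insert i {l. l < length \<pi> \<and> \<pi> ! l < \<pi> ! i}. length (\<alpha>s ! l))"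
    by (subst sum.insert) auto
  also have "\<dots> \<le> (\<Sum>l | l < length \<pi> \<and> \<pi> ! l < \<pi> ! j. length (\<alpha>s ! l))"
    using assms by (intro sum_mono2) auto
  finally show ?thesis .
qed

lemma inflation_shift_bound:
  fixes \<pi> :: "nat list"
  assumes "i < length \<pi>" "length \<alpha>s = length \<pi>"
  shows "(\<Sum>l | l < length \<pi> \<and> \<pi> ! l < \<pi> ! i. length (\<alpha>s ! l)) + length (\<alpha>s ! i)
    \<le> sum_list (map length \<alpha>s)"
proof -
  have "(\<Sum>l | l < length \<pi> \<and> \<pi> ! l < \<pi> ! i. length (\<alpha>s ! l)) + length (\<alpha>s ! i)
      = (\<Sum>l \<in> insert i {l. l < length \<pi> \<and> \<pi> ! l < \<pi> ! i}. length (\<alpha>s ! l))"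
    by (subst sum.insert) auto
  also have "\<dots> \<le> (\<Sum>l \<in> {..<length \<pi>}. length (\<alpha>s ! l))"
    using assms by (intro sum_mono2) auto
  also have "\<dots> = sum_list (map length \<alpha>s)"
    using assms by (simp add: sum_list_sum_nth atLeast0LessThan)
  finally show ?thesis .
qed

lemma
  assumes \<pi>: "is_perm \<pi>" and len: "length \<alpha>s = length \<pi>" and \<alpha>s: "\<And>\<alpha>. \<alpha> \<in> set \<alpha>s \<Longrightarrow> is_perm \<alpha>"
  shows inflation_inflated: "inflated (inflation \<pi> \<alpha>s) \<pi> \<alpha>s"
    and is_perm_inflation: "is_perm (inflation \<pi> \<alpha>s)"
proof -
  define s where "s i = (\<Sum>l | l < length \<pi> \<and> \<pi> ! l < \<pi> ! i. length (\<alpha>s ! l))" for i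
  define xss where "xss = map (\<lambda>i. map (\<lambda>x. x + s i) (\<alpha>s ! i)) [0..<length \<pi>]"
  let ?off = "offset (map length \<alpha>s)"
  have infl: "inflation \<pi> \<alpha>s = concat xss"
    by (simp add: inflation_def xss_def s_def)
  have lens: "map length xss = map length \<alpha>s"
    by (rule nth_equalityI) (simp_all add: xss_def len)
  have length_infl: "length (inflation \<pi> \<alpha>s) = sum_list (map length \<alpha>s)"
    by (simp add: infl length_concat lens)
  have nth_infl: "inflation \<pi> \<alpha>s ! (?off i + p) = \<alpha>s ! i ! p + s i"
    if "i < length \<pi>" "p < length (\<alpha>s ! i)" for i p
    using that nth_concat_offset[of i xss p] unfolding lens by (simp add: infl xss_def)
  have part: "is_perm (\<alpha>s ! i)" if "i < length \<pi>" for i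
    using \<alpha>s that len by simp
  have bounds: "1 \<le> \<alpha>s ! i ! p" "\<alpha>s ! i ! p \<le> length (\<alpha>s ! i)"
    if "i < length \<pi>" "p < length (\<alpha>s ! i)" for i p
    using part[OF that(1)] nth_mem[OF that(2)] by (auto simp: is_perm_iff)
  have across: "\<alpha>s ! i ! p + s i < \<alpha>s ! j ! q + s j"
    if "i < length \<pi>" "j < length \<pi>" "p < length (\<alpha>s ! i)" "q < length (\<alpha>s ! j)" "\<pi> ! i < \<pi> ! j"
    for i j p q
    using inflation_shift_mono[OF that(1,5), of \<alpha>s] bounds[OF that(1,3)] bounds[OF that(2,4)]
    by (simp add: s_def)
  show inflated: "inflated (inflation \<pi> \<alpha>s) \<pi> \<alpha>s"
  proof
    show "length \<alpha>s = length \<pi>" by (rule len)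
    show "length (inflation \<pi> \<alpha>s) = sum_list (map length \<alpha>s)" by (rule length_infl)
    show "0 < length (\<alpha>s ! i)" "distinct (\<alpha>s ! i)" if "i < length \<pi>" for i
      using part[OF that] by (auto simp: is_perm_iff)
    show "distinct \<pi>" using \<pi> by (simp add: is_perm_iff)
    fix i j p q
    assume *: "i < length \<pi>" "j < length \<pi>" "p < length (\<alpha>s ! i)" "q < length (\<alpha>s ! j)"
    have "\<pi> ! i \<noteq> \<pi> ! j" if "i \<noteq> j"
      using * that \<open>distinct \<pi>\<close> by (simp add: nth_eq_iff_index_eq)
    then show "inflation \<pi> \<alpha>s ! (?off i + p) < inflation \<pi> \<alpha>s ! (?off j + q) \<longleftrightarrow>
        (if i = j then \<alpha>s ! i ! p < \<alpha>s ! i ! q else \<pi> ! i < \<pi> ! j)"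
      using across[of i j p q] across[of j i q p] *
      by (cases "\<pi> ! i" "\<pi> ! j" rule: linorder_cases) (auto simp: nth_infl)
  qed
  interpret inflated "inflation \<pi> \<alpha>s" \<pi> \<alpha>s by (rule inflated)
  show "is_perm (inflation \<pi> \<alpha>s)"
  proof (rule distinct_bounded_is_perm)
    have "length \<pi> \<noteq> 0" using \<pi> by (auto simp: is_perm_iff)
    then show "inflation \<pi> \<alpha>s \<noteq> []"
      using off_end off_strict_mono[of 0 "length \<pi>"] by auto
    show "distinct (inflation \<pi> \<alpha>s)" by (rule word_distinct)
    show "set (inflation \<pi> \<alpha>s) \<subseteq> {1..length (inflation \<pi> \<alpha>s)}"
    proof
      fix x assume "x \<in> set (inflation \<pi> \<alpha>s)"
      then obtain r where r: "r < length (inflation \<pi> \<alpha>s)" "x = inflation \<pi> \<alpha>s ! r"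
        by (metis in_set_conv_nth)
      from locate[OF r(1)] obtain i p
        where ip: "i < length \<pi>" "p < length (\<alpha>s ! i)" "r = off i + p" by blast
      then show "x \<in> {1..length (inflation \<pi> \<alpha>s)}"
        using inflation_shift_bound[OF ip(1) len] bounds[OF ip(1,2)] nth_infl[OF ip(1,2)] r(2)
        by (simp add: length_infl s_def)
    qed
  qed
qed

lemma inflated_word_eq:
  assumes w: "is_perm w" "inflated w \<pi> \<alpha>s" and w': "is_perm w'" "inflated w' \<pi> \<alpha>s"
  shows "w = w'"
proof (rule perm_eqI)
  interpret w: inflated w \<pi> \<alpha>s by fact
  interpret w': inflated w' \<pi> \<alpha>s by fact
  show "length w = length w'" by (simp add: w.length_word w'.length_word)
  fix r s assume rs: "r < length w" "s < length w"
  from w.locate[OF rs(1)] w.locate[OF rs(2)] show "w ! r < w ! s \<longleftrightarrow> w' ! r < w' ! s"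
    by (metis w.less_iff w'.less_iff)
qed fact+

text \<open>
  Comparing representatives of two windows recovers the pattern, comparing entries within a window
  recovers the component. Only the window lengths have to be known; equality of the skeletons will
  supply them.
\<close>

lemma inflated_components_unique:
  assumes w: "inflated w \<pi> \<alpha>s" "inflated w \<pi>' \<alpha>s'"
    and lens: "map length \<alpha>s = map length \<alpha>s'"
    and perms: "is_perm \<pi>" "is_perm \<pi>'"
      "\<And>\<alpha>. \<alpha> \<in> set \<alpha>s \<Longrightarrow> is_perm \<alpha>" "\<And>\<alpha>. \<alpha> \<in> set \<alpha>s' \<Longrightarrow> is_perm \<alpha>"
  shows "\<pi> = \<pi>'" "\<alpha>s = \<alpha>s'"
proof -
  interpret w: inflated w \<pi> \<alpha>s by fact
  interpret w': inflated w \<pi>' \<alpha>s' by fact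
  have len: "length \<pi> = length \<pi>'" "length \<alpha>s = length \<alpha>s'"
    using map_eq_imp_length_eq[OF lens] w.length_parts w'.length_parts by auto
  have part: "length (\<alpha>s ! i) = length (\<alpha>s' ! i)" if "i < length \<pi>" for i
    using arg_cong[OF lens, of "\<lambda>xs. xs ! i"] that len by (simp add: w.length_parts w'.length_parts)
  have offs: "w.off = w'.off" by (simp add: lens)
  show "\<pi> = \<pi>'"
  proof (rule perm_eqI)
    fix i j assume ij: "i < length \<pi>" "j < length \<pi>"
    show "\<pi> ! i < \<pi> ! j \<longleftrightarrow> \<pi>' ! i < \<pi>' ! j"
    proof (cases "i = j")
      case False
      then show ?thesis
        using w.less_across_iff[of i j 0 0] w'.less_across_iff[of i j 0 0] ij len offs
          w.parts_nonempty w'.parts_nonempty by simp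
    qed simp
  qed (use perms len in auto)
  show "\<alpha>s = \<alpha>s'"
  proof (rule nth_equalityI)
    fix i assume "i < length \<alpha>s"
    then have i: "i < length \<pi>" by (simp add: w.length_parts)
    show "\<alpha>s ! i = \<alpha>s' ! i"
    proof (rule perm_eqI)
      show "is_perm (\<alpha>s ! i)" "is_perm (\<alpha>s' ! i)"
        using perms i len by (auto simp: w.length_parts w'.length_parts)
      show "length (\<alpha>s ! i) = length (\<alpha>s' ! i)" by (rule part[OF i])
      show "\<alpha>s ! i ! p < \<alpha>s ! i ! q \<longleftrightarrow> \<alpha>s' ! i ! p < \<alpha>s' ! i ! q"
        if "p < length (\<alpha>s ! i)" "q < length (\<alpha>s ! i)" for p q
        using w.less_within_iff[of i p q] w'.less_within_iff[of i p q] i len offs part[OF i] that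
        by simp
    qed
  qed (rule len)
qed

definition factor :: "nat list \<Rightarrow> nat \<Rightarrow> nat \<Rightarrow> nat list" where
  "factor w a n = standardize (take n (drop a w))"

lemma length_factor: "a + n \<le> length w \<Longrightarrow> length (factor w a n) = n"
  by (simp add: factor_def)

lemma factor_less_iff:
  "a + n \<le> length w \<Longrightarrow> p < n \<Longrightarrow> q < n \<Longrightarrow>
     factor w a n ! p < factor w a n ! q \<longleftrightarrow> w ! (a + p) < w ! (a + q)"
  by (simp add: factor_def standardize_less_iff)

lemma is_perm_factor:
  "distinct w \<Longrightarrow> a + n \<le> length w \<Longrightarrow> 0 < n \<Longrightarrow> is_perm (factor w a n)"
  unfolding factor_def by (intro is_perm_standardize) auto

text \<open>
  A criterion for being an inflation that requires no values to be computed: it suffices that entries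
  in different windows compare as the letters of \<open>\<pi>\<close> do. The components are then the standardized
  windows.
\<close>

lemma
  assumes w: "is_perm w" and \<pi>: "is_perm \<pi>"
    and ns: "sum_list ns = length w" "length ns = length \<pi>" "\<And>n. n \<in> set ns \<Longrightarrow> 0 < n"
    and across: "\<And>i j p q. i < length ns \<Longrightarrow> j < length ns \<Longrightarrow> i \<noteq> j \<Longrightarrow> p < ns ! i \<Longrightarrow> q < ns ! j \<Longrightarrow>
      w ! (offset ns i + p) < w ! (offset ns j + q) \<longleftrightarrow> \<pi> ! i < \<pi> ! j"
  defines "\<alpha>s \<equiv> map (\<lambda>i. factor w (offset ns i) (ns ! i)) [0..<length ns]"
  shows eq_inflation_of_factors: "w = inflation \<pi> \<alpha>s"
    and factors_are_perms: "\<And>\<alpha>. \<alpha> \<in> set \<alpha>s \<Longrightarrow> is_perm \<alpha>"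
    and length_factors: "map length \<alpha>s = ns"
proof -
  have fits: "offset ns i + ns ! i \<le> length w" if "i < length ns" for i
    using offset_le[of ns "Suc i"] offset_Suc[OF that] ns(1) by simp
  show lens: "map length \<alpha>s = ns"
    using fits by (intro nth_equalityI) (simp_all add: \<alpha>s_def length_factor)
  show perms: "is_perm \<alpha>" if "\<alpha> \<in> set \<alpha>s" for \<alpha>
    using that w fits ns(3) by (auto simp: \<alpha>s_def is_perm_iff[of w] intro!: is_perm_factor)
  have len: "length \<alpha>s = length \<pi>" by (simp add: \<alpha>s_def ns(2))
  have nth: "\<alpha>s ! i = factor w (offset ns i) (ns ! i)" if "i < length \<pi>" for i
    using that by (simp add: \<alpha>s_def ns(2))
  have "inflated w \<pi> \<alpha>s"
  proof
    show "0 < length (\<alpha>s ! i)" "distinct (\<alpha>s ! i)" if "i < length \<pi>" for i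
      using perms[of "\<alpha>s ! i"] that len by (auto simp: is_perm_iff)
    show "distinct \<pi>" using \<pi> by (simp add: is_perm_iff)
    fix i j p q
    assume *: "i < length \<pi>" "j < length \<pi>" "p < length (\<alpha>s ! i)" "q < length (\<alpha>s ! j)"
    then show "w ! (offset (map length \<alpha>s) i + p) < w ! (offset (map length \<alpha>s) j + q) \<longleftrightarrow>
        (if i = j then \<alpha>s ! i ! p < \<alpha>s ! i ! q else \<pi> ! i < \<pi> ! j)"
      using fits[of i] fits[of j] ns(2) across[of i j p q]
      by (cases "i = j") (simp_all add: lens nth length_factor factor_less_iff)
  qed (simp_all add: len lens ns(1))
  then show "w = inflation \<pi> \<alpha>s"
    by (rule inflated_word_eq[OF w _ is_perm_inflation[OF \<pi> len perms]
          inflation_inflated[OF \<pi> len perms]])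
qed

section \<open>Blocks, and intervals of the inverse permutation\<close>

text \<open>
  Convexity is taken relative to the values that occur in \<open>w\<close>, so the notion depends only on the
  relative order of the entries. For a permutation it means that the window holds consecutive
  integers (\<open>block_perm_iff\<close>).
\<close>

definition block :: "nat list \<Rightarrow> nat \<Rightarrow> nat \<Rightarrow> bool" where
  "block w a b \<longleftrightarrow> a < b \<and> b \<le> length w \<and>
     (\<forall>p \<in> {a..<b}. \<forall>q \<in> {a..<b}. \<forall>r < length w. w ! p < w ! r \<and> w ! r < w ! q \<longrightarrow> r \<in> {a..<b})"

lemma blockI:
  assumes "a < b" "b \<le> length w"
    and "\<And>p q r. p \<in> {a..<b} \<Longrightarrow> q \<in> {a..<b} \<Longrightarrow> r < length w \<Longrightarrow> r \<notin> {a..<b} \<Longrightarrow>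
      w ! p < w ! r \<Longrightarrow> w ! r < w ! q \<Longrightarrow> False"
  shows "block w a b"
  using assms unfolding block_def by blast

lemma block_between:
  "block w a b \<Longrightarrow> p \<in> {a..<b} \<Longrightarrow> q \<in> {a..<b} \<Longrightarrow> r < length w \<Longrightarrow> w ! p < w ! r \<Longrightarrow> w ! r < w ! q \<Longrightarrow>
     r \<in> {a..<b}"
  unfolding block_def by blast

lemma block_bounds: "block w a b \<Longrightarrow> a < b \<and> b \<le> length w"
  by (simp add: block_def)

lemma block_perm_iff:
  assumes "is_perm w"
  shows "block w a b \<longleftrightarrow> a < b \<and> b \<le> length w \<and> (\<exists>v. (!) w ` {a..<b} = {v..<v + (b - a)})"
proof
  assume bl: "block w a b"
  then have ab: "a < b" "b \<le> length w" by (simp_all add: block_def)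
  define S where "S = (!) w ` {a..<b}"
  have fin: "finite S" "S \<noteq> {}" using ab by (auto simp: S_def)
  have dist: "distinct w" and set_w: "set w = {1..length w}"
    using assms by (auto simp: is_perm_iff)
  have "S \<subseteq> set w" using ab by (auto simp: S_def)
  have "S = {Min S..Max S}"
  proof
    show "S \<subseteq> {Min S..Max S}" using fin by auto
    show "{Min S..Max S} \<subseteq> S"
    proof
      fix x assume x: "x \<in> {Min S..Max S}"
      have mm: "Min S \<in> S" "Max S \<in> S" using fin by auto
      then have "x \<in> set w" using x \<open>S \<subseteq> set w\<close> set_w by fastforce
      then obtain r where r: "r < length w" "x = w ! r" by (metis in_set_conv_nth)
      obtain p q where pq: "p \<in> {a..<b}" "Min S = w ! p" "q \<in> {a..<b}" "Max S = w ! q"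
        using mm by (auto simp: S_def)
      show "x \<in> S"
      proof (cases "x = Min S \<or> x = Max S")
        case False
        then have "r \<in> {a..<b}"
          using block_between[OF bl pq(1,3) r(1)] x pq r by auto
        then show ?thesis using r by (auto simp: S_def)
      qed (use mm in auto)
    qed
  qed
  \<comment> \<open>With the cardinality, convexity pins down the endpoints of the image.\<close>
  moreover have "card S = b - a"
    unfolding S_def using dist ab
    by (subst card_image) (auto simp: inj_on_def nth_eq_iff_index_eq)
  ultimately have "S = {Min S..<Min S + (b - a)}"
  proof -
    assume S: "S = {Min S..Max S}" and "card S = b - a"
    from this have "Suc (Max S) - Min S = b - a" by (metis card_atLeastAtMost)
    then have "Suc (Max S) = Min S + (b - a)" using ab by linarith
    with S show ?thesis by (metis atLeastLessThanSuc_atLeastAtMost)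
  qed
  then show "a < b \<and> b \<le> length w \<and> (\<exists>v. (!) w ` {a..<b} = {v..<v + (b - a)})"
    using ab S_def by blast
next
  assume *: "a < b \<and> b \<le> length w \<and> (\<exists>v. (!) w ` {a..<b} = {v..<v + (b - a)})"
  then obtain v where v: "(!) w ` {a..<b} = {v..<v + (b - a)}" by blast
  show "block w a b"
  proof (rule blockI)
    fix p q r
    assume r: "p \<in> {a..<b}" "q \<in> {a..<b}" "r < length w" "r \<notin> {a..<b}" "w ! p < w ! r" "w ! r < w ! q"
    then have "w ! p \<in> {v..<v + (b - a)}" "w ! q \<in> {v..<v + (b - a)}"
      unfolding v[symmetric] by auto
    with r have "w ! r \<in> (!) w ` {a..<b}" unfolding v by auto
    then obtain s where "s \<in> {a..<b}" "w ! r = w ! s" by blast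
    with r * assms show False by (auto simp: is_perm_iff nth_eq_iff_index_eq)
  qed (use * in auto)
qed

text \<open>
  Positions and values are exchanged with a shift by one, as positions are counted from 0 and values
  from 1.
\<close>

lemma
  assumes "is_perm \<sigma>"
  shows is_perm_perm_inverse: "is_perm (perm_inverse \<sigma>)"
    and length_perm_inverse: "length (perm_inverse \<sigma>) = length \<sigma>"
    and perm_inverse_nth_iff: "\<And>x p. x < length \<sigma> \<Longrightarrow> p < length \<sigma> \<Longrightarrow>
      perm_inverse \<sigma> ! x = Suc p \<longleftrightarrow> \<sigma> ! p = Suc x"
proof -
  let ?n = "length \<sigma>"
  have \<sigma>: "distinct \<sigma>" "set \<sigma> = {1..?n}" "\<sigma> \<noteq> []"
    using assms by (auto simp: is_perm_iff)
  have inj: "inj_on ((!) \<sigma>) {..<?n}"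
    using \<sigma>(1) by (auto simp: inj_on_def nth_eq_iff_index_eq)
  have img: "(!) \<sigma> ` {..<?n} = {1..?n}"
    using \<sigma>(2) by (auto simp: set_conv_nth)
  show len: "length (perm_inverse \<sigma>) = ?n"
    by (simp add: perm_inverse_def del: upt_Suc)
  have nth: "perm_inverse \<sigma> ! x = Suc (inv_into {..<?n} ((!) \<sigma>) (Suc x))" if "x < ?n" for x
    using that unfolding perm_inverse_def by (simp del: upt_Suc)
  have inv: "inv_into {..<?n} ((!) \<sigma>) (Suc x) < ?n" "\<sigma> ! inv_into {..<?n} ((!) \<sigma>) (Suc x) = Suc x"
    if "x < ?n" for x
  proof -
    have "Suc x \<in> (!) \<sigma> ` {..<?n}" unfolding img using that by simp
    from inv_into_into[OF this] f_inv_into_f[OF this]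
    show "inv_into {..<?n} ((!) \<sigma>) (Suc x) < ?n" "\<sigma> ! inv_into {..<?n} ((!) \<sigma>) (Suc x) = Suc x"
      by auto
  qed
  show iff: "perm_inverse \<sigma> ! x = Suc p \<longleftrightarrow> \<sigma> ! p = Suc x" if "x < ?n" "p < ?n" for x p
    using inv[OF that(1)] nth[OF that(1)] that inj by (metis inv_into_f_f lessThan_iff nat.inject)
  show "is_perm (perm_inverse \<sigma>)"
  proof (rule distinct_bounded_is_perm)
    show "perm_inverse \<sigma> \<noteq> []" using len \<sigma>(3) by auto
    show "set (perm_inverse \<sigma>) \<subseteq> {1..length (perm_inverse \<sigma>)}"
      using nth inv(1) by (auto simp: in_set_conv_nth len Suc_le_eq)
    show "distinct (perm_inverse \<sigma>)"
      unfolding distinct_conv_nth len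
      using iff inv nth by (metis nat.inject)
  qed
qed

text \<open>
  The condition \<open>\<sigma>({i..<i + h}) = {a + 1..<a + 1 + h}\<close> turns into the same condition for the inverse
  with \<open>i\<close> and \<open>a\<close> exchanged, which is why one implication (\<open>imp\<close>, used twice) is enough.
\<close>

lemma intervals_eq_blocks:
  assumes "is_perm \<sigma>"
  shows "intervals \<sigma> = {{Suc a..b} | a b. block (perm_inverse \<sigma>) a b}"
proof -
  let ?n = "length \<sigma>"
  define \<rho> where "\<rho> = perm_inverse \<sigma>"
  have \<rho>: "is_perm \<rho>" "length \<rho> = ?n"
    using assms is_perm_perm_inverse length_perm_inverse by (auto simp: \<rho>_def)
  have iff: "\<rho> ! x = Suc p \<longleftrightarrow> \<sigma> ! p = Suc x" if "x < ?n" "p < ?n" for x p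
    using perm_inverse_nth_iff[OF assms that] by (simp add: \<rho>_def)
  have range: "\<exists>x < ?n. w ! p = Suc x" if "is_perm w" "length w = ?n" "p < ?n" for w p
  proof -
    have "w ! p \<in> {1..?n}" using that nth_mem[of p w] by (auto simp: is_perm_iff)
    then show ?thesis by (intro exI[of _ "w ! p - 1"]) auto
  qed
  have transfer: "(!) u ` {i..<i + h} = {Suc a..<Suc a + h} \<longleftrightarrow> (!) v ` {a..<a + h} = {Suc i..<Suc i + h}"
    if u: "is_perm u" "length u = ?n" and v: "is_perm v" "length v = ?n"
      and uv: "\<And>x p. x < ?n \<Longrightarrow> p < ?n \<Longrightarrow> v ! x = Suc p \<longleftrightarrow> u ! p = Suc x"
      and le: "i + h \<le> ?n" "a + h \<le> ?n" for u v i a h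
  proof -
    have imp: "(!) v ` {a..<a + h} = {Suc i..<Suc i + h}"
      if eq: "(!) u ` {i..<i + h} = {Suc a..<Suc a + h}"
        and uv: "\<And>x p. x < ?n \<Longrightarrow> p < ?n \<Longrightarrow> v ! x = Suc p \<longleftrightarrow> u ! p = Suc x"
        and le: "i + h \<le> ?n" "a + h \<le> ?n" for u v i a
    proof (intro equalityI subsetI)
      fix y assume "y \<in> (!) v ` {a..<a + h}"
      then obtain x where x: "x \<in> {a..<a + h}" "y = v ! x" by blast
      then have "Suc x \<in> (!) u ` {i..<i + h}" unfolding eq by auto
      then obtain p where p: "p \<in> {i..<i + h}" "u ! p = Suc x" by auto
      then have "v ! x = Suc p" using uv[of x p] x le by auto
      then show "y \<in> {Suc i..<Suc i + h}" using x p by auto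
    next
      fix y assume y: "y \<in> {Suc i..<Suc i + h}"
      then obtain p where p: "y = Suc p" "p \<in> {i..<i + h}" by (cases y) auto
      then have "u ! p \<in> {Suc a..<Suc a + h}" unfolding eq[symmetric] by auto
      then obtain x where x: "u ! p = Suc x" "x \<in> {a..<a + h}" by (cases "u ! p") auto
      then have "v ! x = Suc p" using uv[of x p] p le by auto
      then show "y \<in> (!) v ` {a..<a + h}" using p(1) x(2) by (metis imageI)
    qed
    show ?thesis
      using imp[of u i a v] imp[of v a i u] uv le by blast
  qed
  have "I \<in> intervals \<sigma> \<longleftrightarrow> (\<exists>a b. I = {Suc a..b} \<and> block \<rho> a b)" for I
  proof
    assume "I \<in> intervals \<sigma>"
    then obtain j h i where *: "I = {j..j + h}" "i + h < ?n" "(!) \<sigma> ` {i..i + h} = {j..j + h}"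
      by (auto simp: intervals_def)
    have "j \<in> (!) \<sigma> ` {i..i + h}" "j + h \<in> (!) \<sigma> ` {i..i + h}" unfolding *(3) by auto
    then have "j \<in> set \<sigma>" "j + h \<in> set \<sigma>" using *(2) by auto
    then have "1 \<le> j" "j + h \<le> ?n"
      using assms unfolding is_perm_iff by auto
    then obtain a where a: "j = Suc a" "a + h < ?n"
      by (cases j) auto
    have "(!) \<sigma> ` {i..<i + Suc h} = {Suc a..<Suc a + Suc h}"
      using *(3) a by (simp add: atLeastLessThanSuc_atLeastAtMost)
    then have "(!) \<rho> ` {a..<a + Suc h} = {Suc i..<Suc i + Suc h}"
      using transfer[of \<sigma> \<rho> i "Suc h" a] assms \<rho> iff * a by simp
    then have "block \<rho> a (a + Suc h)"
      unfolding block_perm_iff[OF \<rho>(1)] using a \<rho>(2) by (auto intro!: exI[of _ "Suc i"])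
    then show "\<exists>a b. I = {Suc a..b} \<and> block \<rho> a b"
      using * a by (intro exI[of _ a] exI[of _ "a + Suc h"]) simp
  next
    assume "\<exists>a b. I = {Suc a..b} \<and> block \<rho> a b"
    then obtain a b where *: "I = {Suc a..b}" "block \<rho> a b" by blast
    then obtain v where ab: "a < b" "b \<le> ?n" and v: "(!) \<rho> ` {a..<b} = {v..<v + (b - a)}"
      using \<rho> by (auto simp: block_perm_iff)
    define h where "h = b - a - 1"
    have b: "b = a + Suc h" using ab by (simp add: h_def)
    have "v \<in> (!) \<rho> ` {a..<b}" "v + h \<in> (!) \<rho> ` {a..<b}" unfolding v using b by auto
    then have "v \<in> set \<rho>" "v + h \<in> set \<rho>" using ab \<rho> by auto
    then have "1 \<le> v" "v + h \<le> ?n"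
      using \<rho> unfolding is_perm_iff by auto
    then obtain i where i: "v = Suc i" "i + h < ?n"
      by (cases v) auto
    have "(!) \<sigma> ` {i..<i + Suc h} = {Suc a..<Suc a + Suc h}"
      using transfer[of \<sigma> \<rho> i "Suc h" a] assms \<rho> iff v i b ab by simp
    then have "(!) \<sigma> ` {i..i + h} = {Suc a..Suc a + h}"
      by (simp add: atLeastLessThanSuc_atLeastAtMost)
    then show "I \<in> intervals \<sigma>"
      unfolding intervals_def using * b i by fastforce
  qed
  then show ?thesis by (auto simp: \<rho>_def)
qed

lemma interval_poset_eq_iff:
  assumes "is_perm \<sigma>" "is_perm \<tau>"
  shows "interval_poset \<sigma> = interval_poset \<tau> \<longleftrightarrow> block (perm_inverse \<sigma>) = block (perm_inverse \<tau>)"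
proof
  have *: "block (perm_inverse \<tau>) a b"
    if bl: "block (perm_inverse \<sigma>) a b" and eq: "intervals \<sigma> = intervals \<tau>"
      and \<sigma>: "is_perm \<sigma>" and \<tau>: "is_perm \<tau>" for a b \<sigma> \<tau>
  proof -
    have "{Suc a..b} \<in> intervals \<tau>" using bl eq intervals_eq_blocks[OF \<sigma>] by blast
    then obtain c d where cd: "{Suc a..b} = {Suc c..d}" "block (perm_inverse \<tau>) c d"
      using intervals_eq_blocks[OF \<tau>] by blast
    moreover have "a < b" using bl block_bounds by blast
    ultimately show ?thesis by (auto simp: Icc_eq_Icc)
  qed
  assume "interval_poset \<sigma> = interval_poset \<tau>"
  then have "intervals \<sigma> = intervals \<tau>" by (simp add: interval_poset_def)
  with * assms show "block (perm_inverse \<sigma>) = block (perm_inverse \<tau>)"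
    unfolding fun_eq_iff by metis
next
  assume "block (perm_inverse \<sigma>) = block (perm_inverse \<tau>)"
  then show "interval_poset \<sigma> = interval_poset \<tau>"
    using assms by (simp add: interval_poset_def intervals_eq_blocks)
qed

section \<open>Monotone patterns and cuts\<close>

text \<open>
  Treating \<open><\<close> and \<open>>\<close> as the two values of a parameter handles \<open>\<oplus>\<close> and \<open>\<ominus>\<close> by the same proofs.
\<close>

definition direction :: "(nat \<Rightarrow> nat \<Rightarrow> bool) \<Rightarrow> bool" where
  "direction R \<longleftrightarrow> R = (<) \<or> R = (>)"

definition monotone_perm :: "(nat \<Rightarrow> nat \<Rightarrow> bool) \<Rightarrow> nat \<Rightarrow> nat list" where
  "monotone_perm R k = (if R 0 1 then increasing_perm k else decreasing_perm k)"

lemma length_monotone_perm [simp]: "length (monotone_perm R k) = k"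
  by (simp add: monotone_perm_def increasing_perm_def decreasing_perm_def del: upt_Suc)

lemma is_perm_monotone_perm: "0 < k \<Longrightarrow> is_perm (monotone_perm R k)"
  by (auto simp: is_perm_iff monotone_perm_def increasing_perm_def decreasing_perm_def simp del: upt_Suc)

lemma monotone_perm_nth:
  "direction R \<Longrightarrow> i < j \<Longrightarrow> j < k \<Longrightarrow> R (monotone_perm R k ! i) (monotone_perm R k ! j)"
  by (auto simp: direction_def monotone_perm_def increasing_perm_def decreasing_perm_def rev_nth
      simp del: upt_Suc)

text \<open>
  A cut splits \<open>w\<close> as \<open>\<oplus>[\<alpha>, \<beta>]\<close> (for \<open><\<close>) or as \<open>\<ominus>[\<alpha>, \<beta>]\<close> (for \<open>>\<close>).
\<close>

definition cut :: "(nat \<Rightarrow> nat \<Rightarrow> bool) \<Rightarrow> nat list \<Rightarrow> nat \<Rightarrow> bool" where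
  "cut R w m \<longleftrightarrow> 0 < m \<and> m < length w \<and> (\<forall>p < m. \<forall>q. m \<le> q \<and> q < length w \<longrightarrow> R (w ! p) (w ! q))"

lemma cutD: "cut R w m \<Longrightarrow> p < m \<Longrightarrow> m \<le> q \<Longrightarrow> q < length w \<Longrightarrow> R (w ! p) (w ! q)"
  by (simp add: cut_def)

definition indecomposable :: "(nat \<Rightarrow> nat \<Rightarrow> bool) \<Rightarrow> nat list \<Rightarrow> bool" where
  "indecomposable R \<sigma> \<longleftrightarrow>
     \<not> (\<exists>\<alpha>s. length \<alpha>s \<ge> 2 \<and> (\<forall>\<alpha> \<in> set \<alpha>s. is_perm \<alpha>) \<and>
            \<sigma> = inflation (monotone_perm R (length \<alpha>s)) \<alpha>s)"

lemma block_between_direction: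
  assumes "direction R" "block w a b" "p \<in> {a..<b}" "q \<in> {a..<b}" "r < length w"
    and "R (w ! p) (w ! r)" "R (w ! r) (w ! q)"
  shows "r \<in> {a..<b}"
  using assms block_between[OF assms(2), of p q r] block_between[OF assms(2), of q p r]
  by (auto simp: direction_def)

lemma monotone_block:
  assumes R: "direction R" and \<pi>: "\<And>i j. i < j \<Longrightarrow> j < length \<pi> \<Longrightarrow> R (\<pi> ! i) (\<pi> ! j)"
    and ij: "i < j" "j \<le> length \<pi>"
  shows "block \<pi> i j"
proof (rule blockI)
  fix p q r
  assume *: "p \<in> {i..<j}" "q \<in> {i..<j}" "r < length \<pi>" "r \<notin> {i..<j}" "\<pi> ! p < \<pi> ! r" "\<pi> ! r < \<pi> ! q"
  then consider "r < p" "r < q" | "p < r" "q < r" by fastforce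
  then show False
  proof cases
    case 1
    then have "R (\<pi> ! r) (\<pi> ! p)" "R (\<pi> ! r) (\<pi> ! q)" using \<pi> * ij by auto
    with * R show False by (auto simp: direction_def)
  next
    case 2
    then have "R (\<pi> ! p) (\<pi> ! r)" "R (\<pi> ! q) (\<pi> ! r)" using \<pi> * by auto
    with * R show False by (auto simp: direction_def)
  qed
qed (use ij in auto)

lemma plus_indecomposable_iff: "plus_indecomposable \<sigma> \<longleftrightarrow> indecomposable (<) \<sigma>"
  by (simp add: plus_indecomposable_def indecomposable_def monotone_perm_def)

lemma minus_indecomposable_iff: "minus_indecomposable \<sigma> \<longleftrightarrow> indecomposable (>) \<sigma>"
  by (simp add: minus_indecomposable_def indecomposable_def monotone_perm_def)

lemma (in inflated) direction_across_iff:
  "direction R \<Longrightarrow> i < length \<pi> \<Longrightarrow> j < length \<pi> \<Longrightarrow> p < length (\<alpha>s ! i) \<Longrightarrow> q < length (\<alpha>s ! j) \<Longrightarrow>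
    i \<noteq> j \<Longrightarrow> R (w ! (off i + p)) (w ! (off j + q)) \<longleftrightarrow> R (\<pi> ! i) (\<pi> ! j)"
  by (auto simp: direction_def less_across_iff)

lemma (in inflated) direction_within_iff:
  "direction R \<Longrightarrow> i < length \<pi> \<Longrightarrow> p < length (\<alpha>s ! i) \<Longrightarrow> q < length (\<alpha>s ! i) \<Longrightarrow>
    R (w ! (off i + p)) (w ! (off i + q)) \<longleftrightarrow> R (\<alpha>s ! i ! p) (\<alpha>s ! i ! q)"
  by (auto simp: direction_def less_within_iff)

lemma monotone_inflationI:
  assumes w: "is_perm w" and R: "direction R"
    and ns: "sum_list ns = length w" "ns \<noteq> []" "\<And>n. n \<in> set ns \<Longrightarrow> 0 < n"
    and cuts: "\<And>i. 0 < i \<Longrightarrow> i < length ns \<Longrightarrow> cut R w (offset ns i)"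
  defines "\<alpha>s \<equiv> map (\<lambda>i. factor w (offset ns i) (ns ! i)) [0..<length ns]"
  shows "w = inflation (monotone_perm R (length ns)) \<alpha>s"
    and "\<And>\<alpha>. \<alpha> \<in> set \<alpha>s \<Longrightarrow> is_perm \<alpha>"
proof -
  have less: "R (w ! (offset ns i + p)) (w ! (offset ns j + q))"
    if "i < j" "j < length ns" "p < ns ! i" "q < ns ! j" for i j p q
  proof -
    have "cut R w (offset ns j)" using cuts that by simp
    from cutD[OF this, of "offset ns i + p" "offset ns j + q"] show ?thesis
      using that offset_add_less[of i j ns p] offset_add_less[of j "length ns" ns q]
      by (simp add: ns(1))
  qed
  have across: "w ! (offset ns i + p) < w ! (offset ns j + q) \<longleftrightarrow>
      monotone_perm R (length ns) ! i < monotone_perm R (length ns) ! j"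
    if "i < length ns" "j < length ns" "i \<noteq> j" "p < ns ! i" "q < ns ! j" for i j p q
    using R less[of i j p q] less[of j i q p] monotone_perm_nth[OF R, of i j "length ns"]
      monotone_perm_nth[OF R, of j i "length ns"] that
    unfolding direction_def by (cases i j rule: linorder_cases) auto
  have perm: "is_perm (monotone_perm R (length ns))"
    using ns(2) by (intro is_perm_monotone_perm) simp
  show "w = inflation (monotone_perm R (length ns)) \<alpha>s"
    unfolding \<alpha>s_def by (rule eq_inflation_of_factors[OF w perm ns(1) _ ns(3) across]) simp_all
  show "is_perm \<alpha>" if "\<alpha> \<in> set \<alpha>s" for \<alpha>
    using factors_are_perms[OF w perm ns(1) _ ns(3) across] that unfolding \<alpha>s_def by simp
qed

text \<open>
  A cut yields a decomposition into two components; conversely the end of the first component of any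
  decomposition is a cut.
\<close>

lemma indecomposable_iff_no_cut:
  assumes w: "is_perm w" and R: "direction R"
  shows "indecomposable R w \<longleftrightarrow> (\<forall>m. \<not> cut R w m)"
proof
  assume ind: "indecomposable R w"
  show "\<forall>m. \<not> cut R w m"
  proof (intro allI notI)
    fix m assume m: "cut R w m"
    define ns where "ns = [m, length w - m]"
    have ns: "sum_list ns = length w" "ns \<noteq> []" "\<And>n. n \<in> set ns \<Longrightarrow> 0 < n" "length ns = 2"
      using m by (auto simp: ns_def cut_def)
    have "cut R w (offset ns i)" if "0 < i" "i < length ns" for i
    proof -
      have "i = 1" using that by (simp add: ns_def)
      then show ?thesis using m by (simp add: ns_def offset_def)
    qed
    note mono = monotone_inflationI[OF w R ns(1-3) this]
    let ?\<alpha>s = "map (\<lambda>i. factor w (offset ns i) (ns ! i)) [0..<length ns]"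
    have "length ?\<alpha>s = length ns" by simp
    with mono(1,2) have "2 \<le> length ?\<alpha>s \<and> (\<forall>\<alpha> \<in> set ?\<alpha>s. is_perm \<alpha>) \<and>
        w = inflation (monotone_perm R (length ?\<alpha>s)) ?\<alpha>s"
      unfolding ns(4) by simp
    with ind show False unfolding indecomposable_def by blast
  qed
next
  assume no_cut: "\<forall>m. \<not> cut R w m"
  show "indecomposable R w"
    unfolding indecomposable_def
  proof (intro notI, elim exE conjE)
    fix \<alpha>s assume \<alpha>s: "length \<alpha>s \<ge> 2" "\<forall>\<alpha> \<in> set \<alpha>s. is_perm \<alpha>"
      and eq: "w = inflation (monotone_perm R (length \<alpha>s)) \<alpha>s"
    interpret inflated w "monotone_perm R (length \<alpha>s)" \<alpha>s
      unfolding eq by (rule inflation_inflated) (use \<alpha>s in \<open>auto intro!: is_perm_monotone_perm\<close>)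
    have "cut R w (off 1)"
      unfolding cut_def
    proof (intro conjI allI impI)
      show "0 < off 1" using off_strict_mono[of 0 1] \<alpha>s(1) by simp
      show "off 1 < length w" using off_strict_mono[of 1 "length \<alpha>s"] off_end \<alpha>s(1) by simp
      fix p q assume p: "p < off 1" and q: "off 1 \<le> q \<and> q < length w"
      have "0 < length \<alpha>s" using \<alpha>s(1) by linarith
      then have off_1: "off 1 = length (\<alpha>s ! 0)" using off_Suc[of 0] by simp
      have p0: "p < length (\<alpha>s ! 0)" using p unfolding off_1 .
      obtain j q' where j: "j < length \<alpha>s" "q' < length (\<alpha>s ! j)" "q = off j + q'"
        using locate q by (metis length_monotone_perm)
      have "j \<noteq> 0" using j q off_1 by (intro notI) simp
      then show "R (w ! p) (w ! q)"
        using direction_across_iff[OF R, of 0 j p q'] monotone_perm_nth[OF R, of 0 j] j p0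
          \<open>0 < length \<alpha>s\<close>
        by simp
    qed
    with no_cut show False by blast
  qed
qed

section \<open>Blocks of an inflation\<close>

lemma simple_perm_block:
  assumes "simple_perm \<pi>" "block \<pi> i j"
  shows "j = Suc i \<or> i = 0 \<and> j = length \<pi>"
proof -
  have \<pi>: "is_perm \<pi>" "\<And>I. I \<in> intervals \<pi> \<Longrightarrow> (\<exists>v. I = {v}) \<or> I = {1..length \<pi>}"
    using assms(1) by (auto simp: simple_perm_def)
  obtain v where ij: "i < j" "j \<le> length \<pi>" and v: "(!) \<pi> ` {i..<j} = {v..<v + (j - i)}"
    using assms(2) \<pi>(1) by (auto simp: block_perm_iff)
  define h where "h = j - i - 1"
  have j: "j = i + h + 1" using ij by (simp add: h_def)
  have "(!) \<pi> ` {i..i + h} = {v..v + h}"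
    using v unfolding j by (simp add: atLeastLessThanSuc_atLeastAtMost)
  then have "{v..v + h} \<in> intervals \<pi>"
    unfolding intervals_def using ij j by (intro CollectI exI conjI) auto
  from \<pi>(2)[OF this] show ?thesis
  proof
    assume "\<exists>u. {v..v + h} = {u}"
    then have "h = 0" by (metis add_eq_self_zero atLeastAtMost_singleton_iff)
    then show ?thesis using j by simp
  next
    assume "{v..v + h} = {1..length \<pi>}"
    then have "card {v..v + h} = length \<pi>" by simp
    then show ?thesis using ij j by simp
  qed
qed

context inflated
begin

lemma block_component_iff:
  assumes "i < length \<pi>"
  shows "block w (off i + a) (off i + b) \<and> off i + b \<le> off (Suc i) \<longleftrightarrow> block (\<alpha>s ! i) a b"
proof
  assume "block w (off i + a) (off i + b) \<and> off i + b \<le> off (Suc i)"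
  then have bl: "block w (off i + a) (off i + b)" and le: "b \<le> length (\<alpha>s ! i)"
    using assms by (auto simp: off_Suc)
  show "block (\<alpha>s ! i) a b"
  proof (rule blockI)
    fix p q r
    assume *: "p \<in> {a..<b}" "q \<in> {a..<b}" "r < length (\<alpha>s ! i)" "r \<notin> {a..<b}"
      "\<alpha>s ! i ! p < \<alpha>s ! i ! r" "\<alpha>s ! i ! r < \<alpha>s ! i ! q"
    then have "w ! (off i + p) < w ! (off i + r)" "w ! (off i + r) < w ! (off i + q)"
      using assms le by (auto simp: less_within_iff)
    with * have "off i + r \<in> {off i + a..<off i + b}"
      using * assms block_between[OF bl, of "off i + p" "off i + q" "off i + r"]
      by (simp add: position_less)
    with * show False by simp
  qed (use block_bounds[OF bl] le in auto)
next
  assume bl: "block (\<alpha>s ! i) a b"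
  then have ab: "a < b" "b \<le> length (\<alpha>s ! i)" by (auto dest: block_bounds)
  then have le: "off i + b \<le> off (Suc i)" using assms by (simp add: off_Suc)
  moreover have "block w (off i + a) (off i + b)"
  proof (rule blockI)
    show "off i + b \<le> length w" using le off_le[of "Suc i"] by simp
    fix p q r
    assume *: "p \<in> {off i + a..<off i + b}" "q \<in> {off i + a..<off i + b}" "r < length w"
      "r \<notin> {off i + a..<off i + b}" "w ! p < w ! r" "w ! r < w ! q"
    from locate[OF *(3)] obtain j r' where r: "j < length \<pi>" "r' < length (\<alpha>s ! j)" "r = off j + r'"
      by blast
    define p' q' where "p' = p - off i" and "q' = q - off i"
    then have pq: "p = off i + p'" "q = off i + q'" "p' \<in> {a..<b}" "q' \<in> {a..<b}"
      using *(1,2) by auto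
    show False
    proof (cases "j = i")
      case True
      then show False
        using * r pq assms ab block_between[OF bl pq(3,4), of r'] by (auto simp: less_within_iff)
    next
      case False
      then show False
        using * r pq assms ab by (auto simp: less_across_iff)
    qed
  qed (use ab in simp)
  ultimately show "block w (off i + a) (off i + b) \<and> off i + b \<le> off (Suc i)" by simp
qed

text \<open>
  The two endpoints of a block lie either in one window or in different ones. The characterizations
  below concern the second case.
\<close>

lemma block_locate:
  assumes "block w a b"
  obtains (component) i a' b' where "i < length \<pi>" "a = off i + a'" "b = off i + b'" "block (\<alpha>s ! i) a' b'"
  | (across) i a' j b' where "i < j" "j < length \<pi>" "a' < length (\<alpha>s ! i)" "b' < length (\<alpha>s ! j)"
      "a = off i + a'" "b = Suc (off j + b')"
proof -
  have ab: "a < b" "b \<le> length w" using block_bounds[OF assms] by auto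
  obtain i a' where i: "i < length \<pi>" "a' < length (\<alpha>s ! i)" "a = off i + a'"
    using locate[of a] ab by auto
  have "b - 1 < length w" using ab by simp
  from locate[OF this] obtain j b' where j: "j < length \<pi>" "b' < length (\<alpha>s ! j)" "b - 1 = off j + b'"
    by blast
  then have b: "b = Suc (off j + b')" using ab by simp
  show thesis
  proof (cases i j rule: linorder_cases)
    case less
    then show thesis using i j b by (intro across) auto
  next
    case equal
    have "off i + Suc b' \<le> off (Suc i)" using j equal by (simp add: off_Suc)
    then have "block (\<alpha>s ! i) a' (Suc b')"
      using assms block_component_iff[OF i(1), of a' "Suc b'"] i b equal by simp
    then show thesis using i b equal by (intro component[of i a' "Suc b'"]) auto
  next
    case greater
    then have "b \<le> a" using off_add_less[of j i b'] j b i by simp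
    with ab show thesis by simp
  qed
qed

text \<open>
  A letter of \<open>\<pi>\<close> outside \<open>[i, j)\<close> strictly between two letters inside would force all entries of its
  window into the block, while one of them is not in it. It suffices that each window outside is not
  contained in the block; this is what makes the lemma applicable to a window that is cut in two.
\<close>

lemma block_across_pattern:
  assumes bl: "block w a b" and ij: "i < j" "j \<le> length \<pi>"
    and meets: "\<And>l. l \<in> {i..<j} \<Longrightarrow> \<exists>p < length (\<alpha>s ! l). off l + p \<in> {a..<b}"
    and avoids: "\<And>l. l < length \<pi> \<Longrightarrow> l \<notin> {i..<j} \<Longrightarrow> \<exists>p < length (\<alpha>s ! l). off l + p \<notin> {a..<b}"
  shows "block \<pi> i j"
proof (rule blockI)
  fix l m r
  assume *: "l \<in> {i..<j}" "m \<in> {i..<j}" "r < length \<pi>" "r \<notin> {i..<j}" "\<pi> ! l < \<pi> ! r" "\<pi> ! r < \<pi> ! m"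
  obtain p where p: "p < length (\<alpha>s ! l)" "off l + p \<in> {a..<b}" using meets[OF *(1)] by blast
  obtain q where q: "q < length (\<alpha>s ! m)" "off m + q \<in> {a..<b}" using meets[OF *(2)] by blast
  obtain s where s: "s < length (\<alpha>s ! r)" "off r + s \<notin> {a..<b}" using avoids[OF *(3,4)] by blast
  have "w ! (off l + p) < w ! (off r + s)" "w ! (off r + s) < w ! (off m + q)"
    using * p q s ij by (auto simp: less_across_iff)
  then have "off r + s \<in> {a..<b}"
    using block_between[OF bl p(2) q(2), of "off r + s"] * s by (simp add: position_less)
  with s show False by simp
qed (use ij in auto)

text \<open>
  The windows met by the block form a block of \<open>\<pi>\<close> with at least two letters, so all windows are met.
  If the block missed a position of the first window, then the other windows would form a block of
  \<open>\<pi>\<close> too, and similarly for the last window. With at least four letters that block would be neither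
  a single letter nor all of \<open>\<pi>\<close>.
\<close>

lemma simple_block_across:
  assumes \<pi>: "simple_perm \<pi>" and bl: "block w a b"
    and ij: "i < j" "j < length \<pi>" "a' < length (\<alpha>s ! i)" "b' < length (\<alpha>s ! j)"
    and ab: "a = off i + a'" "b = Suc (off j + b')"
  shows "a = 0 \<and> b = length w"
proof -
  have four: "4 \<le> length \<pi>" using \<pi> by (simp add: simple_perm_def)
  have le: "off l + p < off m + q" if "l < m" "m < length \<pi>" "p < length (\<alpha>s ! l)" for l m p q
    using off_add_less[of l m p] that by simp
  have meets: "\<exists>p < length (\<alpha>s ! l). off l + p \<in> {a..<b}" if l: "l \<in> {i..j}" for l
  proof -
    have "l < length \<pi>" using l ij by auto
    note ne = parts_nonempty[OF this]
    consider "l = i" | "l = j" | "i < l" "l < j" using l by fastforce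
    then show ?thesis
    proof cases
      case 1
      then show ?thesis using ij ab le[of i j a' b'] by (intro exI[of _ a']) auto
    next
      case 2
      then show ?thesis using ij ab le[of i j a' b'] by (intro exI[of _ b']) auto
    next
      case 3
      then show ?thesis
        using ij ab le[of i l a' 0] le[of l j 0 b'] ne by (intro exI[of _ 0]) auto
    qed
  qed
  have outside: "off l + p \<notin> {a..<b}"
    if "l < length \<pi>" "l \<notin> {i..j}" "p < length (\<alpha>s ! l)" for l p
    using that le[of l i p a'] le[of j l b' p] ij ab by (auto simp: not_le)
  \<comment> \<open>The windows met are exactly those from \<open>i\<close> to \<open>j\<close>.\<close>
  have "block \<pi> i (Suc j)"
  proof (rule block_across_pattern[OF bl])
    show "\<exists>p < length (\<alpha>s ! l). off l + p \<in> {a..<b}" if "l \<in> {i..<Suc j}" for l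
      using meets that by auto
    show "\<exists>p < length (\<alpha>s ! l). off l + p \<notin> {a..<b}" if "l < length \<pi>" "l \<notin> {i..<Suc j}" for l
      using outside[of l 0] that parts_nonempty[of l] by auto
  qed (use ij in auto)
  from simple_perm_block[OF \<pi> this] ij have all: "i = 0" "Suc j = length \<pi>" by auto
  have "a = 0"
  proof (rule ccontr)
    assume "a \<noteq> 0"
    have "block \<pi> 1 (length \<pi>)"
    proof (rule block_across_pattern[OF bl])
      show "\<exists>p < length (\<alpha>s ! l). off l + p \<in> {a..<b}" if "l \<in> {1..<length \<pi>}" for l
        using meets that all by auto
      show "\<exists>p < length (\<alpha>s ! l). off l + p \<notin> {a..<b}" if "l < length \<pi>" "l \<notin> {1..<length \<pi>}" for l
      proof -
        have "l = 0" using that by auto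
        then show ?thesis using parts_nonempty[of 0] \<open>a \<noteq> 0\<close> that(1) by (intro exI[of _ 0]) auto
      qed
    qed (use four in auto)
    from simple_perm_block[OF \<pi> this] four show False by auto
  qed
  moreover have "b = length w"
  proof (rule ccontr)
    assume "b \<noteq> length w"
    then have b: "b < length w" using block_bounds[OF bl] by simp
    have last: "length w = off j + length (\<alpha>s ! j)" using off_end off_Suc[of j] all ij by simp
    have "block \<pi> 0 j"
    proof (rule block_across_pattern[OF bl])
      show "\<exists>p < length (\<alpha>s ! l). off l + p \<in> {a..<b}" if "l \<in> {0..<j}" for l
        using meets that all by auto
      show "\<exists>p < length (\<alpha>s ! l). off l + p \<notin> {a..<b}" if "l < length \<pi>" "l \<notin> {0..<j}" for l
      proof -
        have "l = j" using that all by auto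
        then show ?thesis
          using b last ij ab by (intro exI[of _ "Suc b'"]) auto
      qed
    qed (use ij all in auto)
    from simple_perm_block[OF \<pi> this] four all show False by auto
  qed
  ultimately show ?thesis by simp
qed

lemma block_whole: "0 < length \<pi> \<Longrightarrow> block w 0 (length w)"
  using off_strict_mono[of 0 "length \<pi>"] off_end by (intro blockI) auto

text \<open>
  Suppose that the block starts inside window \<open>i\<close>, at its position \<open>a' > 0\<close>. An earlier entry of this
  window precedes, in the direction \<open>R\<close>, the entries of window \<open>j\<close> in the block. Being outside the
  block, it must precede every entry of the block, in particular those of window \<open>i\<close> from \<open>a'\<close> on. So
  \<open>a'\<close> is a cut of the component. The right end is symmetric.
\<close>

lemma monotone_block_across:
  assumes R: "direction R" and \<pi>: "\<And>i j. i < j \<Longrightarrow> j < length \<pi> \<Longrightarrow> R (\<pi> ! i) (\<pi> ! j)"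
    and no_cut: "\<And>i m. i < length \<pi> \<Longrightarrow> \<not> cut R (\<alpha>s ! i) m"
    and bl: "block w a b"
    and ij: "i < j" "j < length \<pi>" "a' < length (\<alpha>s ! i)" "b' < length (\<alpha>s ! j)"
    and ab: "a = off i + a'" "b = Suc (off j + b')"
  shows "a = off i \<and> b = off (Suc j)"
proof -
  have i: "i < length \<pi>" using ij by simp
  have R_cases: "R x y \<or> R y x" if "x \<noteq> y" for x y using R that by (auto simp: direction_def)
  note between = block_between_direction[OF R bl]
  have a_less: "a < off j" "off j < b"
    using off_add_less[OF ij(1) i ij(3)] ab by auto
  have "a' = 0"
  proof (rule ccontr)
    assume "a' \<noteq> 0"
    have "cut R (\<alpha>s ! i) a'"
      unfolding cut_def
    proof (intro conjI allI impI)
      fix p q assume p: "p < a'" and q: "a' \<le> q \<and> q < length (\<alpha>s ! i)"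
      have "R (w ! (off i + p)) (w ! (off j + b'))"
        using direction_across_iff[OF R i ij(2), of p b'] \<pi>[OF ij(1,2)] p ij by simp
      moreover have "off i + p \<notin> {a..<b}" "off j + b' \<in> {a..<b}"
        using p a_less ab by auto
      moreover have "off i + q \<in> {a..<b}"
        using q ab a_less off_add_less[of i j q] ij by auto
      moreover have "off i + p < length w" using p ij i by (simp add: position_less)
      ultimately have "\<not> R (w ! (off i + q)) (w ! (off i + p))"
        using between[of "off i + q" "off j + b'" "off i + p"] by blast
      moreover have "w ! (off i + q) \<noteq> w ! (off i + p)"
        using word_distinct p q ij i by (simp add: nth_eq_iff_index_eq position_less)
      ultimately have "R (w ! (off i + p)) (w ! (off i + q))" using R_cases by blast
      then show "R (\<alpha>s ! i ! p) (\<alpha>s ! i ! q)"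
        using direction_within_iff[OF R i, of p q] p q by simp
    qed (use \<open>a' \<noteq> 0\<close> ij in auto)
    with no_cut[OF i] show False by blast
  qed
  moreover have "Suc b' = length (\<alpha>s ! j)"
  proof (rule ccontr)
    assume "Suc b' \<noteq> length (\<alpha>s ! j)"
    have "cut R (\<alpha>s ! j) (Suc b')"
      unfolding cut_def
    proof (intro conjI allI impI)
      fix p q assume p: "p < Suc b'" and q: "Suc b' \<le> q \<and> q < length (\<alpha>s ! j)"
      have "R (w ! a) (w ! (off j + q))"
        using direction_across_iff[OF R i ij(2), of a' q] \<pi>[OF ij(1,2)] q ij ab by simp
      moreover have "off j + q \<notin> {a..<b}" "a \<in> {a..<b}" "off j + p \<in> {a..<b}"
        using p q a_less ab by auto
      moreover have "off j + q < length w" using q ij by (simp add: position_less)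
      ultimately have "\<not> R (w ! (off j + q)) (w ! (off j + p))"
        using between[of a "off j + p" "off j + q"] by blast
      moreover have "w ! (off j + q) \<noteq> w ! (off j + p)"
        using word_distinct p q ij by (simp add: nth_eq_iff_index_eq position_less)
      ultimately have "R (w ! (off j + p)) (w ! (off j + q))" using R_cases by blast
      then show "R (\<alpha>s ! j ! p) (\<alpha>s ! j ! q)"
        using direction_within_iff[OF R ij(2), of p q] p q by simp
    qed (use \<open>Suc b' \<noteq> length (\<alpha>s ! j)\<close> ij in auto)
    with no_cut[OF ij(2)] show False by blast
  qed
  ultimately show ?thesis using ab ij by (auto simp: off_Suc)
qed

lemma block_of_pattern_block:
  assumes bl: "block \<pi> i j"
  shows "block w (off i) (off j)"
proof (rule blockI)
  have ij: "i < j" "j \<le> length \<pi>" using block_bounds[OF bl] by auto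
  show "off i < off j" using ij by (simp add: off_strict_mono)
  show "off j \<le> length w" by (rule off_le)
  have inside: "l \<in> {i..<j} \<longleftrightarrow> off l + p \<in> {off i..<off j}" if "l < length \<pi>" "p < length (\<alpha>s ! l)" for l p
    using that off_add_less[of l j p] off_add_less[of l i p] offset_mono[of i l "map length \<alpha>s"]
      offset_mono[of j l "map length \<alpha>s"]
    by (cases "l < i"; cases "l < j") auto
  fix p q r
  assume *: "p \<in> {off i..<off j}" "q \<in> {off i..<off j}" "r < length w" "r \<notin> {off i..<off j}"
    "w ! p < w ! r" "w ! r < w ! q"
  then have "p < length w" "q < length w" using off_le[of j] by auto
  obtain l p' where l: "l < length \<pi>" "p' < length (\<alpha>s ! l)" "p = off l + p'"
    using locate[OF \<open>p < length w\<close>] by blast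
  obtain m q' where m: "m < length \<pi>" "q' < length (\<alpha>s ! m)" "q = off m + q'"
    using locate[OF \<open>q < length w\<close>] by blast
  obtain n r' where n: "n < length \<pi>" "r' < length (\<alpha>s ! n)" "r = off n + r'"
    using locate[OF *(3)] by blast
  have ins: "l \<in> {i..<j}" "m \<in> {i..<j}" "n \<notin> {i..<j}"
    using inside[OF l(1,2)] inside[OF m(1,2)] inside[OF n(1,2)] * l m n by auto
  then have "l \<noteq> n" "n \<noteq> m" by auto
  then have "\<pi> ! l < \<pi> ! n" "\<pi> ! n < \<pi> ! m"
    using * l m n less_across_iff by auto
  with block_between[OF bl ins(1,2) n(1)] ins(3) show False by blast
qed

end

section \<open>The block system of a skeleton\<close>

primrec leaves :: "'l plane_tree \<Rightarrow> nat" where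
  "leaves Leaf = 1"
| "leaves (Node l ts) = sum_list (map leaves ts)"

text \<open>
  The arities that can occur in a decomposition tree: a simple permutation has size at least 4. Without
  the bound for prime nodes, a prime node with two children would have the same block system as a
  linear one.
\<close>

fun reduced :: "node_kind plane_tree \<Rightarrow> bool" where
  "reduced Leaf \<longleftrightarrow> True"
| "reduced (Node k ts) \<longleftrightarrow> (if k = Prime then 4 else 2) \<le> length ts \<and> (\<forall>t \<in> set ts. reduced t)"

text \<open>
  The windows that are blocks of any permutation with the given skeleton.
\<close>

inductive tree_block :: "node_kind plane_tree \<Rightarrow> nat \<Rightarrow> nat \<Rightarrow> bool" where
  leaf: "tree_block Leaf 0 1"
| union: "i < i' \<Longrightarrow> i' \<le> length ts \<Longrightarrow> k = Linear \<or> i = 0 \<and> i' = length ts \<Longrightarrow>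
    tree_block (Node k ts) (offset (map leaves ts) i) (offset (map leaves ts) i')"
| child: "i < length ts \<Longrightarrow> tree_block (ts ! i) a b \<Longrightarrow>
    tree_block (Node k ts) (offset (map leaves ts) i + a) (offset (map leaves ts) i + b)"

lemma leaves_pos: "reduced t \<Longrightarrow> 0 < leaves t"
proof (induction t)
  case (Node k ts)
  then have "ts \<noteq> []" by (auto split: if_splits)
  with Node show ?case
    by (cases ts) auto
qed simp

lemma leaves_Node_ge_2:
  assumes "reduced (Node k ts)"
  shows "2 \<le> leaves (Node k ts)"
proof -
  have "2 \<le> length ts" "\<And>t. t \<in> set ts \<Longrightarrow> reduced t"
    using assms by (auto split: if_splits)
  then obtain t u us where "ts = t # u # us" "reduced t" "reduced u"
    by (cases ts; cases "tl ts") auto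
  then show ?thesis
    using leaves_pos[of t] leaves_pos[of u] by simp
qed

lemma tree_block_bounds:
  "tree_block t a b \<Longrightarrow> reduced t \<Longrightarrow> a < b \<and> b \<le> leaves t"
proof (induction rule: tree_block.induct)
  case (union i i' ts k)
  have "0 < n" if "n \<in> set (map leaves ts)" for n
    using that union.prems leaves_pos by auto
  with union show ?case
    using offset_strict_mono[of i i' "map leaves ts"] offset_le[of "map leaves ts" i'] by simp
next
  case (child i ts a b k)
  then have "reduced (ts ! i)" by simp
  with child show ?case
    using offset_Suc[of i "map leaves ts"] offset_le[of "map leaves ts" "Suc i"] by simp
qed simp

lemma tree_block_whole:
  assumes "reduced t"
  shows "tree_block t 0 (leaves t)"
proof (cases t)
  case (Node k ts)
  with assms have "0 < length ts" by (auto split: if_splits)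
  then show ?thesis
    using tree_block.union[of 0 "length ts" ts k] offset_length[of "map leaves ts"]
    by (simp add: Node)
qed (use tree_block.leaf in simp)

locale reduced_node =
  fixes k :: node_kind and ts :: "node_kind plane_tree list"
  assumes reduced_node: "reduced (Node k ts)"
begin

abbreviation off :: "nat \<Rightarrow> nat" where
  "off \<equiv> offset (map leaves ts)"

lemma children_reduced: "i < length ts \<Longrightarrow> reduced (ts ! i)"
  using reduced_node by simp

lemma arity: "2 \<le> length ts" "k = Prime \<Longrightarrow> 4 \<le> length ts"
  using reduced_node by (auto split: if_splits)

lemma off_less: "i < j \<Longrightarrow> j \<le> length ts \<Longrightarrow> off i < off j"
  using reduced_node leaves_pos by (intro offset_strict_mono) auto

lemma off_less_iff: "i \<le> length ts \<Longrightarrow> j \<le> length ts \<Longrightarrow> off i < off j \<longleftrightarrow> i < j"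
  using off_less[of i j] off_less[of j i] by (cases i j rule: linorder_cases) auto

lemma off_le_iff: "i \<le> length ts \<Longrightarrow> j \<le> length ts \<Longrightarrow> off i \<le> off j \<longleftrightarrow> i \<le> j"
  using off_less_iff[of j i] by linarith

lemma off_eq_iff: "i \<le> length ts \<Longrightarrow> j \<le> length ts \<Longrightarrow> off i = off j \<longleftrightarrow> i = j"
  using off_le_iff[of i j] off_le_iff[of j i] by auto

lemma off_end: "off (length ts) = leaves (Node k ts)"
  using offset_length[of "map leaves ts"] by simp

lemma off_Suc: "i < length ts \<Longrightarrow> off (Suc i) = off i + leaves (ts ! i)"
  by (simp add: offset_Suc)

lemma block_cases:
  assumes "tree_block (Node k ts) a b"
  obtains (child) i a' b' where "i < length ts" "a = off i + a'" "b = off i + b'" "tree_block (ts ! i) a' b'"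
      "a < b" "b \<le> off (Suc i)"
  | (union) i i' where "i + 2 \<le> i'" "i' \<le> length ts" "a = off i" "b = off i'"
      "k = Linear \<or> i = 0 \<and> i' = length ts"
  using assms
proof cases
  case (union i i')
  show thesis
  proof (cases "i' = Suc i")
    case True
    with union have i: "i < length ts" by simp
    with union True off_less[of i "Suc i"] show thesis
      by (intro child[of i 0 "leaves (ts ! i)"]) (auto simp: tree_block_whole children_reduced off_Suc)
  next
    case False
    with union show thesis by (intro that(2)[of i i']) auto
  qed
next
  case (child i a' b')
  then have "a' < b' \<and> b' \<le> leaves (ts ! i)"
    using tree_block_bounds children_reduced by blast
  with child show thesis by (intro that(1)[of i a' b']) (auto simp: off_Suc)
qed

text \<open>
  The block system of a child is recovered from that of the tree and the window of the child.
\<close>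

lemma child_block_iff:
  assumes "i < length ts"
  shows "tree_block (ts ! i) a b \<longleftrightarrow> tree_block (Node k ts) (off i + a) (off i + b) \<and> off i + b \<le> off (Suc i)"
proof safe
  assume "tree_block (ts ! i) a b"
  with assms show "tree_block (Node k ts) (off i + a) (off i + b)" "off i + b \<le> off (Suc i)"
    using tree_block.child[of i ts a b k] tree_block_bounds[of "ts ! i" a b]
    by (auto simp: children_reduced off_Suc)
next
  assume *: "tree_block (Node k ts) (off i + a) (off i + b)" "off i + b \<le> off (Suc i)"
  from *(1) show "tree_block (ts ! i) a b"
  proof (cases rule: block_cases)
    case (child j a' b')
    then have "off j < off (Suc i)" "off i < off (Suc j)" using *(2) by auto
    then have "i = j" using child(1) assms by (simp add: off_less_iff)
    with child show ?thesis by simp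
  next
    case (union j j')
    then have "off i \<le> off j" "off j' \<le> off (Suc i)" using *(2) by auto
    then have "i \<le> j" "j' \<le> Suc i" using union assms by (simp_all add: off_le_iff)
    with union(1) show ?thesis by simp
  qed
qed

end

text \<open>
  \<open>[a, b)\<close> and \<open>[c, d)\<close> intersect and none contains the other; the disjuncts are the two possible
  arrangements.
\<close>

definition overlap :: "nat \<Rightarrow> nat \<Rightarrow> nat \<Rightarrow> nat \<Rightarrow> bool" where
  "overlap a b c d \<longleftrightarrow> a < c \<and> c < b \<and> b < d \<or> c < a \<and> a < d \<and> d < b"

text \<open>
  The proper blocks that overlap no block, following the usual terminology of strong intervals.
\<close>

definition strong_block :: "node_kind plane_tree \<Rightarrow> nat \<Rightarrow> nat \<Rightarrow> bool" where
  "strong_block t a b \<longleftrightarrow> tree_block t a b \<and> (a, b) \<noteq> (0, leaves t) \<and>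
     (\<forall>c d. tree_block t c d \<longrightarrow> \<not> overlap a b c d)"

context reduced_node
begin

lemma child_strong:
  assumes "i < length ts"
  shows "strong_block (Node k ts) (off i) (off (Suc i))"
  unfolding strong_block_def
proof (intro conjI allI impI)
  show "tree_block (Node k ts) (off i) (off (Suc i))"
    using assms child_block_iff[of i 0 "leaves (ts ! i)"] tree_block_whole children_reduced
    by (simp add: off_Suc)
  show "(off i, off (Suc i)) \<noteq> (0, leaves (Node k ts))"
    using assms arity(1) off_eq_iff[of i 0] off_eq_iff[of "Suc i" "length ts"] off_end by auto
  fix c d assume "tree_block (Node k ts) c d"
  then show "\<not> overlap (off i) (off (Suc i)) c d"
  proof (cases rule: block_cases)
    case (child j)
    then have "off j \<le> c" by simp
    moreover have "Suc i \<le> j \<or> j = i \<or> Suc j \<le> i" by linarith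
    ultimately show ?thesis
      using child assms offset_mono[of "Suc i" j "map leaves ts"] offset_mono[of "Suc j" i "map leaves ts"]
      by (auto simp: overlap_def)
  next
    case (union j j')
    then show ?thesis
      using assms by (auto simp: overlap_def off_less_iff)
  qed
qed

text \<open>
  A union of at least two but not all children can be a block only under a linear node. It has a
  neighbouring child on one side, and the union of this child with the adjacent one inside overlaps
  it.
\<close>

lemma strong_within_child:
  assumes "strong_block (Node k ts) a b"
  obtains i where "i < length ts" "off i \<le> a" "b \<le> off (Suc i)"
proof -
  have ab: "tree_block (Node k ts) a b" "(a, b) \<noteq> (0, leaves (Node k ts))"
    and no: "\<And>c d. tree_block (Node k ts) c d \<Longrightarrow> \<not> overlap a b c d"
    using assms by (auto simp: strong_block_def)
  from ab(1) show thesis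
  proof (cases rule: block_cases)
    case (child i)
    then show thesis by (intro that[of i]) auto
  next
    case (union i i')
    have "\<not> (i = 0 \<and> i' = length ts)"
      using ab(2) union off_end by auto
    with union have lin: "k = Linear" and "0 < i \<or> i' < length ts" by auto
    then consider "0 < i" | "i' < length ts" by blast
    then show thesis
    proof cases
      case 1
      have "tree_block (Node k ts) (off (i - 1)) (off (Suc i))"
        using union lin 1 by (intro tree_block.union) auto
      then have "\<not> overlap a b (off (i - 1)) (off (Suc i))" by (rule no)
      then show thesis using union 1 by (auto simp: overlap_def off_less_iff)
    next
      case 2
      have "tree_block (Node k ts) (off (i' - 1)) (off (Suc i'))"
        using union lin 2 by (intro tree_block.union) auto
      then have "\<not> overlap a b (off (i' - 1)) (off (Suc i'))" by (rule no)
      then show thesis using union 2 by (auto simp: overlap_def off_less_iff)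
    qed
  qed
qed

lemma first_two_children_block_iff:
  "tree_block (Node k ts) 0 (off 2) \<longleftrightarrow> k = Linear \<or> length ts = 2"
proof
  assume "tree_block (Node k ts) 0 (off 2)"
  then show "k = Linear \<or> length ts = 2"
  proof (cases rule: block_cases)
    case (child i)
    then have "off i = off 0" by simp
    then have "i = 0" using child(1) off_eq_iff[of i 0] by simp
    then show ?thesis using child arity(1) off_le_iff[of 2 "Suc 0"] by simp
  next
    case (union i i')
    then have "i' = 2" using arity(1) off_eq_iff[of 2 i'] by simp
    with union show ?thesis by auto
  qed
next
  assume "k = Linear \<or> length ts = 2"
  then show "tree_block (Node k ts) 0 (off 2)"
    using tree_block.union[of 0 2 ts k] arity(1) by auto
qed

end

text \<open>
  The \<open>i\<close>-th child of the first tree is a strong block, hence contained in a child of the second tree,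
  which in turn is contained in a child of the first. The latter must be the \<open>i\<close>-th child again, so
  both inclusions are equalities.
\<close>

lemma offsets_agree:
  assumes "reduced_node k ts" "reduced_node k' ts'"
    and eq: "tree_block (Node k ts) = tree_block (Node k' ts')" "leaves (Node k ts) = leaves (Node k' ts')"
    and "i \<le> length ts"
  shows "i \<le> length ts' \<and> offset (map leaves ts) i = offset (map leaves ts') i"
  using \<open>i \<le> length ts\<close>
proof (induction i)
  case (Suc i)
  interpret A: reduced_node k ts by fact
  interpret B: reduced_node k' ts' by fact
  have strong_eq: "strong_block (Node k ts) = strong_block (Node k' ts')"
    using eq by (simp add: fun_eq_iff strong_block_def)
  have i: "i < length ts" using Suc.prems by simp
  have ii': "i \<le> length ts'" "A.off i = B.off i" using Suc by auto
  have "strong_block (Node k' ts') (A.off i) (A.off (Suc i))"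
    using A.child_strong[OF i] strong_eq by simp
  then obtain j where j: "j < length ts'" "B.off j \<le> A.off i" "A.off (Suc i) \<le> B.off (Suc j)"
    by (rule B.strong_within_child)
  have "strong_block (Node k ts) (B.off j) (B.off (Suc j))"
    using B.child_strong[OF j(1)] strong_eq by simp
  then obtain l where l: "l < length ts" "A.off l \<le> B.off j" "B.off (Suc j) \<le> A.off (Suc l)"
    by (rule A.strong_within_child)
  have "A.off l \<le> A.off i" "A.off (Suc i) \<le> A.off (Suc l)" using j l by auto
  then have "l = i" using i l(1) by (simp add: A.off_le_iff)
  with j l have *: "B.off j = A.off i" "B.off (Suc j) = A.off (Suc i)" by auto
  then have "j = i" using ii' j(1) B.off_eq_iff[of j i] by simp
  with * j show ?case by simp
qed simp

text \<open>
  Comparing where the children of the roots start gives equal windows, hence equal block systems of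
  corresponding children, to which the induction hypothesis applies.
\<close>

theorem tree_block_inj:
  "reduced t \<Longrightarrow> reduced t' \<Longrightarrow> tree_block t = tree_block t' \<Longrightarrow> t = t'"
proof (induction t arbitrary: t')
  have leaves_eq: "leaves t = leaves t'" if "reduced t" "reduced t'" "tree_block t = tree_block t'" for t t'
    using that tree_block_whole[of t] tree_block_whole[of t'] tree_block_bounds[of t 0 "leaves t'"]
      tree_block_bounds[of t' 0 "leaves t"] by auto
  {
    case Leaf
    then show ?case
      using leaves_eq[OF Leaf(1,2,3)] leaves_Node_ge_2 by (cases t') fastforce+
  next
    case (Node k ts)
    note leaves = leaves_eq[OF Node.prems]
    obtain k' ts' where t': "t' = Node k' ts'"
      using leaves leaves_Node_ge_2[OF Node.prems(1)] by (cases t') auto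
    have A: "reduced_node k ts" and B: "reduced_node k' ts'"
      using Node.prems by (simp_all add: reduced_node_def t')
    interpret A: reduced_node k ts by (rule A)
    interpret B: reduced_node k' ts' by (rule B)
    note eq = Node.prems(3)[unfolded t'] and leaves = leaves[unfolded t']
    have len: "length ts = length ts'"
      using offsets_agree[OF A B eq leaves, of "length ts"]
        offsets_agree[OF B A eq[symmetric] leaves[symmetric], of "length ts'"] by simp
    have off: "A.off i = B.off i" if "i \<le> length ts" for i
      using offsets_agree[OF A B eq leaves that] by simp
    have "ts = ts'"
    proof (rule nth_equalityI[OF len])
      fix i assume i: "i < length ts"
      have "tree_block (ts ! i) = tree_block (ts' ! i)"
        using i len eq off[of i] off[of "Suc i"]
        by (simp add: fun_eq_iff A.child_block_iff B.child_block_iff)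
      then show "ts ! i = ts' ! i"
        using Node.IH[of "ts ! i" "ts' ! i"] i len A.children_reduced B.children_reduced by simp
    qed
    moreover have "k = k'"
    proof -
      \<comment> \<open>Whether the first two children form a block tells linear nodes from prime ones, except for
        two children; then the node is linear by its arity.\<close>
      have "k = Linear \<or> length ts = 2 \<longleftrightarrow> k' = Linear \<or> length ts = 2"
        using A.first_two_children_block_iff B.first_two_children_block_iff off[of 2] A.arity(1) eq len
        by simp
      then show ?thesis
        using A.arity B.arity len by (cases k; cases k') auto
    qed
    ultimately show ?case by (simp add: t')
  }
qed

section \<open>Decomposition trees: blocks and uniqueness\<close>

text \<open>
  The two monotone cases of the definition are merged into one with a direction as parameter.
\<close>

lemma substitution_decomposition_iff:
  "substitution_decomposition \<sigma> \<pi> \<alpha>s \<longleftrightarrow>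
     length \<alpha>s = length \<pi> \<and> (\<forall>\<alpha> \<in> set \<alpha>s. is_perm \<alpha>) \<and> \<sigma> = inflation \<pi> \<alpha>s \<and>
     (simple_perm \<pi> \<or>
      (\<exists>R. direction R \<and> 2 \<le> length \<pi> \<and> \<pi> = monotone_perm R (length \<pi>) \<and>
         (\<forall>\<alpha> \<in> set \<alpha>s. indecomposable R \<alpha>)))"
proof -
  have len: "length (increasing_perm k) = k" "length (decreasing_perm k) = k" for k
    by (simp_all add: increasing_perm_def decreasing_perm_def del: upt_Suc)
  have ex: "(\<exists>k \<ge> 2. \<pi> = f k \<and> Q) \<longleftrightarrow> 2 \<le> length \<pi> \<and> \<pi> = f (length \<pi>) \<and> Q"
    if "\<And>k. length (f k) = k" for f Q
    using that by metis
  show ?thesis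
    unfolding substitution_decomposition_def ex[OF len(1)] ex[OF len(2)] direction_def
      plus_indecomposable_iff minus_indecomposable_iff
    by (auto simp: monotone_perm_def)
qed

lemma substitution_decomposition_cases:
  assumes "substitution_decomposition w \<pi> \<alpha>s"
  obtains (simple) "inflated w \<pi> \<alpha>s" "is_perm \<pi>" "\<And>\<alpha>. \<alpha> \<in> set \<alpha>s \<Longrightarrow> is_perm \<alpha>"
      "simple_perm \<pi>" "4 \<le> length \<pi>"
  | (monotone) R where "inflated w \<pi> \<alpha>s" "is_perm \<pi>" "\<And>\<alpha>. \<alpha> \<in> set \<alpha>s \<Longrightarrow> is_perm \<alpha>"
      "\<not> simple_perm \<pi>" "2 \<le> length \<pi>" "direction R"
      "\<And>i j. i < j \<Longrightarrow> j < length \<pi> \<Longrightarrow> R (\<pi> ! i) (\<pi> ! j)"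
      "\<And>i m. i < length \<pi> \<Longrightarrow> \<not> cut R (\<alpha>s ! i) m"
proof -
  have *: "length \<alpha>s = length \<pi>" "\<And>\<alpha>. \<alpha> \<in> set \<alpha>s \<Longrightarrow> is_perm \<alpha>" "w = inflation \<pi> \<alpha>s"
    using assms by (auto simp: substitution_decomposition_iff)
  show thesis
  proof (cases "simple_perm \<pi>")
    case True
    then have "is_perm \<pi>" "4 \<le> length \<pi>" by (simp_all add: simple_perm_def)
    with True * show thesis by (intro simple) (auto intro: inflation_inflated)
  next
    case False
    with assms obtain R where R: "direction R" "2 \<le> length \<pi>" "\<pi> = monotone_perm R (length \<pi>)"
      "\<forall>\<alpha> \<in> set \<alpha>s. indecomposable R \<alpha>"
      by (auto simp: substitution_decomposition_iff)
    have perm: "is_perm \<pi>"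
      by (subst R(3)) (use R(2) in \<open>auto intro: is_perm_monotone_perm\<close>)
    then have infl: "inflated w \<pi> \<alpha>s" using * by (auto intro: inflation_inflated)
    have mono: "R (\<pi> ! i) (\<pi> ! j)" if "i < j" "j < length \<pi>" for i j
      using monotone_perm_nth[OF R(1) that] unfolding R(3)[symmetric] .
    have no_cut: "\<not> cut R (\<alpha>s ! i) m" if "i < length \<pi>" for i m
      using R(1,4) * that indecomposable_iff_no_cut by simp
    show thesis
      by (rule monotone[OF infl perm *(2) False R(2,1) mono no_cut])
  qed
qed

lemma skeleton_Leaf: "skeleton Leaf = Leaf"
  by (simp add: skeleton_def)

lemma skeleton_Node:
  "skeleton (Node (root_label \<pi>) ts) = Node (if simple_perm \<pi> then Prime else Linear) (map skeleton ts)"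
  by (auto simp: skeleton_def root_label_def)

text \<open>
  A block inside one child is covered by the induction hypothesis, a block across several children by
  \<open>simple_block_across\<close> or \<open>monotone_block_across\<close>. Leaf counts are part of the
  induction because they determine the windows of the children.
\<close>

theorem block_eq_tree_block:
  assumes "is_decomposition_tree w t"
  shows "reduced (skeleton t) \<and> leaves (skeleton t) = length w \<and> block w = tree_block (skeleton t)"
  using assms
proof induction
  case leaf
  have "block [1] a b \<longleftrightarrow> a = 0 \<and> b = 1" for a b
    by (auto simp: block_def)
  moreover have "tree_block Leaf a b \<longleftrightarrow> a = 0 \<and> b = 1" for a b
    by (auto intro: tree_block.leaf[simplified] elim: tree_block.cases)
  ultimately show ?case by (simp add: skeleton_Leaf fun_eq_iff)
next
  case (node w \<pi> \<alpha>s ts)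
  define ss where "ss = map skeleton ts"
  define k where "k = (if simple_perm \<pi> then Prime else Linear)"
  have sk: "skeleton (Node (root_label \<pi>) ts) = Node k ss"
    by (simp add: skeleton_Node k_def ss_def)
  have "inflated w \<pi> \<alpha>s"
    using node.hyps by (rule substitution_decomposition_cases)
  then interpret inflated w \<pi> \<alpha>s .
  have len: "length ss = length \<pi>"
    using list_all2_lengthD[OF node.IH] by (simp add: ss_def length_parts)
  have IH: "reduced (ss ! i)" "leaves (ss ! i) = length (\<alpha>s ! i)" "block (\<alpha>s ! i) = tree_block (ss ! i)"
    if "i < length \<pi>" for i
    using list_all2_nthD[OF node.IH, of i] that list_all2_lengthD[OF node.IH]
    by (simp_all add: ss_def length_parts)
  have lens: "map leaves ss = map length \<alpha>s"
    by (rule nth_equalityI) (simp_all add: len length_parts IH)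
  have red: "reduced (Node k ss)"
    using node.hyps
  proof (cases rule: substitution_decomposition_cases)
    case simple
    then show ?thesis using IH(1) len by (auto simp: k_def in_set_conv_nth)
  next
    case (monotone R)
    then show ?thesis using IH(1) len by (auto simp: k_def in_set_conv_nth)
  qed
  have lv: "leaves (Node k ss) = length w"
    by (simp add: lens length_word)
  have "block w a b \<longleftrightarrow> tree_block (Node k ss) a b" for a b
  proof
    assume bl: "block w a b"
    from bl show "tree_block (Node k ss) a b"
    proof (cases rule: block_locate)
      case (component i a' b')
      then show ?thesis
        using tree_block.child[of i ss a' b' k] IH(3) by (simp add: len lens)
    next
      case (across i a' j b')
      from node.hyps show ?thesis
      proof (cases rule: substitution_decomposition_cases)
        case simple
        then have "a = 0 \<and> b = length w"
          by (intro simple_block_across[OF _ bl across]) auto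
        then show ?thesis using tree_block_whole[OF red] lv by simp
      next
        case (monotone R)
        have "a = off i \<and> b = off (Suc j)"
          by (rule monotone_block_across[OF monotone(6-8) bl across])
        then show ?thesis
          using tree_block.union[of i "Suc j" ss k] across monotone(4) by (simp add: k_def len lens)
      qed
    qed
  next
    assume "tree_block (Node k ss) a b"
    then show "block w a b"
    proof cases
      case (union i j)
      show ?thesis
      proof (cases "simple_perm \<pi>")
        case True
        then have "i = 0" "j = length \<pi>" using union by (auto simp: k_def len)
        then show ?thesis using union block_whole off_end by (simp add: lens len)
      next
        case False
        with node.hyps obtain R where R: "direction R"
          "\<And>i j. i < j \<Longrightarrow> j < length \<pi> \<Longrightarrow> R (\<pi> ! i) (\<pi> ! j)"
          by (cases rule: substitution_decomposition_cases) auto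
        have "block \<pi> i j" using union len by (intro monotone_block[OF R]) auto
        then show ?thesis using block_of_pattern_block union by (simp add: lens)
      qed
    next
      case (child i a' b')
      then show ?thesis
        using block_component_iff[of i a' b'] IH(3)[of i] by (simp add: len lens)
    qed
  qed
  then show ?case using red lv by (simp add: sk fun_eq_iff)
qed

lemma skeleton_eq_iff_block_eq:
  assumes "is_decomposition_tree w t" "is_decomposition_tree w' t'"
  shows "skeleton t = skeleton t' \<longleftrightarrow> block w = block w'"
  using block_eq_tree_block[OF assms(1)] block_eq_tree_block[OF assms(2)] tree_block_inj by metis

text \<open>
  Both trees have the skeleton prescribed by the blocks of \<open>w\<close>, so the two decompositions at the root
  use the same windows. This forces the same pattern, hence the same label, and the same components.
\<close>

lemma decomposition_tree_unique:
  "is_decomposition_tree w t \<Longrightarrow> is_decomposition_tree w t' \<Longrightarrow> t = t'"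
proof (induction arbitrary: t' rule: is_decomposition_tree.induct)
  case leaf
  have "skeleton Leaf = skeleton t'"
    using skeleton_eq_iff_block_eq[OF is_decomposition_tree.leaf leaf] by simp
  then show ?case by (cases t') (simp_all add: skeleton_def)
next
  case (node w \<pi> \<alpha>s ts)
  have trees: "list_all2 is_decomposition_tree \<alpha>s ts"
    using node.IH by (rule list_all2_mono) blast
  have sk: "skeleton (Node (root_label \<pi>) ts) = skeleton t'"
    using skeleton_eq_iff_block_eq[OF is_decomposition_tree.node[OF node.hyps trees] node.prems] by simp
  from node.prems show ?case
  proof cases
    case leaf
    with sk show ?thesis by (simp add: skeleton_def)
  next
    case (node \<pi>' \<alpha>s' ts')
    have parts_lengths: "map length \<alpha>s = map leaves (map skeleton ts)"
      if "list_all2 is_decomposition_tree \<alpha>s ts" for \<alpha>s and ts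
      using that block_eq_tree_block
      by (induction rule: list_all2_induct) auto
    have "map skeleton ts = map skeleton ts'"
      using sk node by (simp add: skeleton_Node)
    then have lens: "map length \<alpha>s = map length \<alpha>s'"
      using parts_lengths[OF trees] parts_lengths[OF node(3)] by simp
    have 1: "inflated w \<pi> \<alpha>s \<and> is_perm \<pi> \<and> (\<forall>\<alpha> \<in> set \<alpha>s. is_perm \<alpha>)"
      using \<open>substitution_decomposition w \<pi> \<alpha>s\<close> by (cases rule: substitution_decomposition_cases) auto
    have 2: "inflated w \<pi>' \<alpha>s' \<and> is_perm \<pi>' \<and> (\<forall>\<alpha> \<in> set \<alpha>s'. is_perm \<alpha>)"
      using node(2) by (cases rule: substitution_decomposition_cases) auto
    have "\<pi> = \<pi>'" "\<alpha>s = \<alpha>s'"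
      using inflated_components_unique[OF _ _ lens] 1 2 by blast+
    moreover have "ts = ts'"
      using node.IH node(3) \<open>\<alpha>s = \<alpha>s'\<close>
      by (intro nth_equalityI) (auto simp: list_all2_conv_all_nth)
    ultimately show ?thesis using node(1) by simp
  qed
qed

section \<open>Existence of decomposition trees\<close>

text \<open>
  The common position \<open>c\<close> makes any third entry lie on the same side of both blocks.
\<close>

lemma block_union:
  assumes "distinct w" and ab: "block w a b" and cd: "block w c d" and "a \<le> c" "c < b" "b \<le> d"
  shows "block w a d"
proof (rule blockI)
  fix p q r
  assume *: "p \<in> {a..<d}" "q \<in> {a..<d}" "r < length w" "r \<notin> {a..<d}" "w ! p < w ! r" "w ! r < w ! q"
  have c: "c \<in> {a..<b}" "c \<in> {c..<d}" "c < length w" "r \<noteq> c"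
    using assms(4-6) block_bounds[OF ab] * by auto
  then have "w ! c \<noteq> w ! r" using \<open>distinct w\<close> *(3) by (simp add: nth_eq_iff_index_eq)
  moreover have "\<not> (w ! p' < w ! r \<and> w ! r < w ! q')" if "p' \<in> {a..<b}" "q' \<in> {a..<b}" for p' q'
    using block_between[OF ab that *(3)] * assms(4-6) by auto
  moreover have "\<not> (w ! p' < w ! r \<and> w ! r < w ! q')" if "p' \<in> {c..<d}" "q' \<in> {c..<d}" for p' q'
    using block_between[OF cd that *(3)] * assms(4-6) by auto
  moreover have "p \<in> {a..<b} \<or> p \<in> {c..<d}" "q \<in> {a..<b} \<or> q \<in> {c..<d}"
    using * assms(4-6) by auto
  ultimately show False using *(5,6) c(1,2) by (meson linorder_neqE_nat)
qed (use assms(4-6) block_bounds[OF cd] in auto)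

text \<open>
  The entry at position 0 is not in the suffix block, so all entries from \<open>d\<close> on lie on the same side
  of it. The prefix being a block, they lie on that side of the whole prefix.
\<close>

lemma covering_blocks_cut:
  assumes "distinct w" and pre: "block w 0 d" and suf: "block w e (length w)" and "0 < e" "e \<le> d" "d < length w"
  shows "\<exists>R. direction R \<and> cut R w d"
proof -
  have neq: "w ! p \<noteq> w ! q" if "p < length w" "q < length w" "p \<noteq> q" for p q
    using \<open>distinct w\<close> that by (simp add: nth_eq_iff_index_eq)
  have d: "0 < d" using assms by simp
  then obtain R where R: "direction R" "R (w ! 0) (w ! d)"
    using neq[of 0 d] assms(6) unfolding direction_def by (metis linorder_neqE_nat not_less_zero gr_zeroI)
  have R_cases: "R x y \<or> R y x" if "x \<noteq> y" for x y using R(1) that by (auto simp: direction_def)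
  have "R (w ! p) (w ! q)" if p: "p < d" and q: "d \<le> q" "q < length w" for p q
  proof (rule ccontr)
    assume "\<not> R (w ! p) (w ! q)"
    then have qp: "R (w ! q) (w ! p)" using R_cases neq[of p q] p q by auto
    have "R (w ! 0) (w ! q)"
    proof (rule ccontr)
      assume "\<not> R (w ! 0) (w ! q)"
      moreover have "w ! 0 \<noteq> w ! q" by (rule neq) (use d q in auto)
      ultimately have "R (w ! q) (w ! 0)" using R_cases by blast
      then have "0 \<in> {e..<length w}"
        by (intro block_between_direction[OF R(1) suf, of q d 0]) (use R(2) q assms in auto)
      with \<open>0 < e\<close> show False by simp
    qed
    then have "q \<in> {0..<d}"
      using block_between_direction[OF R(1) pre, of 0 p q] qp p q d by auto
    with q show False by simp
  qed
  then show ?thesis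
    using R(1) assms d by (auto simp: cut_def)
qed

lemma disjoint_blocks_uniform:
  assumes "distinct w" and ab: "block w a b" and cd: "block w c d" and dis: "{a..<b} \<inter> {c..<d} = {}"
    and "p \<in> {a..<b}" "p' \<in> {a..<b}" "q \<in> {c..<d}" "q' \<in> {c..<d}" "w ! p < w ! q"
  shows "w ! p' < w ! q'"
proof -
  have neq: "w ! x \<noteq> w ! y" if "x \<in> {a..<b}" "y \<in> {c..<d}" for x y
  proof -
    have "x < length w" "y < length w" "x \<noteq> y"
      using that block_bounds[OF ab] block_bounds[OF cd] dis by auto
    then show ?thesis using \<open>distinct w\<close> by (simp add: nth_eq_iff_index_eq)
  qed
  have "q < length w" "p' < length w" using assms block_bounds[OF ab] block_bounds[OF cd] by auto
  have "w ! p' < w ! q"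
  proof (rule ccontr)
    assume "\<not> w ! p' < w ! q"
    then have "w ! q < w ! p'" using neq[OF assms(6,7)] by simp
    from block_between[OF ab assms(5,6) \<open>q < length w\<close> assms(9) this] dis assms(7) show False by blast
  qed
  show ?thesis
  proof (rule ccontr)
    assume "\<not> w ! p' < w ! q'"
    then have "w ! q' < w ! p'" using neq[OF assms(6,8)] by simp
    from block_between[OF cd assms(8,7) \<open>p' < length w\<close> this \<open>w ! p' < w ! q\<close>] dis assms(6)
    show False by blast
  qed
qed

lemma simple_permI:
  assumes "is_perm \<pi>" "4 \<le> length \<pi>"
    and blocks: "\<And>i j. block \<pi> i j \<Longrightarrow> j = Suc i \<or> i = 0 \<and> j = length \<pi>"
  shows "simple_perm \<pi>"
  unfolding simple_perm_def
proof (intro conjI ballI)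
  fix I assume "I \<in> intervals \<pi>"
  then obtain v h i where I: "I = {v..v + h}" "i + h < length \<pi>" "(!) \<pi> ` {i..i + h} = {v..v + h}"
    by (auto simp: intervals_def)
  then have "block \<pi> i (Suc (i + h))"
    unfolding block_perm_iff[OF assms(1)]
    by (auto simp: atLeastLessThanSuc_atLeastAtMost intro!: exI[of _ v])
  from blocks[OF this] show "(\<exists>v. I = {v}) \<or> I = {1..length \<pi>}"
  proof
    assume "i = 0 \<and> Suc (i + h) = length \<pi>"
    then have "{i..i + h} = {..<length \<pi>}" by auto
    then have "I = (!) \<pi> ` {..<length \<pi>}"
      using I(1,3) by simp
    also have "\<dots> = set \<pi>" by (auto simp: set_conv_nth)
    finally show ?thesis using assms(1) by (simp add: is_perm_iff)
  qed (use I in auto)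
qed (use assms in auto)

text \<open>
  Guarantees that decomposing along all cuts leaves indecomposable components.
\<close>

lemma cut_of_factor:
  assumes R: "direction R" and ab: "a < b" "b \<le> length w"
    and a: "a = 0 \<or> cut R w a" and b: "b = length w \<or> cut R w b"
    and m: "cut R (factor w a (b - a)) m"
  shows "cut R w (a + m)" "0 < m" "a + m < b"
proof -
  have len: "length (factor w a (b - a)) = b - a" using ab by (simp add: length_factor)
  show m_bounds: "0 < m" "a + m < b" using m len by (auto simp: cut_def)
  have within: "R (w ! (a + p)) (w ! (a + q))" if "p < m" "m \<le> q" "a + q < b" for p q
    using cutD[OF m, of p q] factor_less_iff[of a "b - a" w p q] factor_less_iff[of a "b - a" w q p]
      R len that ab m_bounds by (auto simp: direction_def)
  show "cut R w (a + m)"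
    unfolding cut_def
  proof (intro conjI allI impI)
    fix p q assume p: "p < a + m" and q: "a + m \<le> q \<and> q < length w"
    consider "p < a" | "b \<le> q" | "a \<le> p" "q < b" by linarith
    then show "R (w ! p) (w ! q)"
    proof cases
      case 1
      then show ?thesis using a q by (auto intro: cutD[where m = a])
    next
      case 2
      then show ?thesis using b q p m_bounds by (auto intro: cutD[where m = b])
    next
      case 3
      then have "p - a < m" "m \<le> q - a" "a + (q - a) < b" using p q by linarith+
      from within[OF this] show ?thesis using 3 p q by simp
    qed
  qed (use m_bounds ab in auto)
qed

lemma decomposition_along_cuts:
  assumes w: "is_perm w" and R: "direction R" and m: "cut R w m"
  shows "\<exists>\<pi> \<alpha>s. substitution_decomposition w \<pi> \<alpha>s"
proof -
  define M where "M = {0, length w} \<union> {m. cut R w m}"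
  have "0 \<in> M" "length w \<in> M" "M \<subseteq> {..length w}" by (auto simp: M_def cut_def)
  then obtain ns where ns: "\<And>x. x \<in> set ns \<Longrightarrow> 0 < x" "sum_list ns = length w"
    and M: "M = offset ns ` {..length ns}"
    by (rule finite_set_as_offsets) blast
  have less: "offset ns i < offset ns j" if "i < j" "j \<le> length ns" for i j
    using offset_strict_mono that ns(1) by blast
  have offset_end: "offset ns (length ns) = length w" by (simp add: ns(2))
  obtain l where l: "l \<le> length ns" "m = offset ns l"
    using m M by (auto simp: M_def)
  have "l \<noteq> 0" using m l by (intro notI) (simp add: cut_def)
  have "l \<noteq> length ns" using m l offset_end by (intro notI) (simp add: cut_def)
  with \<open>l \<noteq> 0\<close> have two: "2 \<le> length ns" using l(1) by linarith
  then have "ns \<noteq> []" by auto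
  have M_cases: "offset ns i \<in> M" if "i \<le> length ns" for i using M that by auto
  have cuts: "cut R w (offset ns i)" if "0 < i" "i < length ns" for i
    using M_cases[of i] less[of 0 i] less[of i "length ns"] offset_end that by (auto simp: M_def)
  define \<alpha>s where "\<alpha>s = map (\<lambda>i. factor w (offset ns i) (ns ! i)) [0..<length ns]"
  have infl: "w = inflation (monotone_perm R (length ns)) \<alpha>s"
    and perms: "\<And>\<alpha>. \<alpha> \<in> set \<alpha>s \<Longrightarrow> is_perm \<alpha>"
    using monotone_inflationI[OF w R ns(2) \<open>ns \<noteq> []\<close> ns(1) cuts] by (auto simp: \<alpha>s_def)
  have "indecomposable R \<alpha>" if "\<alpha> \<in> set \<alpha>s" for \<alpha>
    unfolding indecomposable_iff_no_cut[OF perms[OF that] R]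
  proof (intro allI notI)
    fix c assume c: "cut R \<alpha> c"
    from that obtain i where i: "i < length ns" "\<alpha> = factor w (offset ns i) (ns ! i)"
      by (auto simp: \<alpha>s_def)
    let ?a = "offset ns i" and ?b = "offset ns (Suc i)"
    have ab: "?a < ?b" "?b \<le> length w" "ns ! i = ?b - ?a"
      using i less[of i "Suc i"] offset_le[of ns "Suc i"] by (simp_all add: ns(2) offset_Suc)
    have a: "?a = 0 \<or> cut R w ?a" using cuts[of i] i by (cases "i = 0") auto
    have b: "?b = length w \<or> cut R w ?b" using cuts[of "Suc i"] i offset_end by (cases "Suc i = length ns") auto
    note c = cut_of_factor[OF R ab(1,2) a b c[unfolded i(2) ab(3)]]
    then obtain l where l: "l \<le> length ns" "?a + c = offset ns l"
      using M by (auto simp: M_def)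
    have "i < l"
      by (rule ccontr) (use offset_mono[of l i ns] l c in auto)
    moreover have "l < Suc i"
      by (rule ccontr) (use offset_mono[of "Suc i" l ns] l c in auto)
    ultimately show False by simp
  qed
  moreover have "length \<alpha>s = length ns" by (simp add: \<alpha>s_def)
  ultimately have "substitution_decomposition w (monotone_perm R (length ns)) \<alpha>s"
    unfolding substitution_decomposition_iff length_monotone_perm using infl perms two R by blast
  then show ?thesis by blast
qed

text \<open>
  At most one of the three letters is in the middle in value, so either the last letter does not
  separate the first two or the first letter does not separate the last two.
\<close>

lemma three_letters_not_simple:
  assumes "length \<pi> = 3"
  shows "block \<pi> 0 2 \<or> block \<pi> 1 3"
proof (cases "\<pi> ! 0 < \<pi> ! 2 \<and> \<pi> ! 2 < \<pi> ! 1 \<or> \<pi> ! 1 < \<pi> ! 2 \<and> \<pi> ! 2 < \<pi> ! 0")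
  case True
  have "block \<pi> 1 3"
  proof (rule blockI)
    fix p q r
    assume *: "p \<in> {1..<3}" "q \<in> {1..<3}" "r < length \<pi>" "r \<notin> {1..<3}" "\<pi> ! p < \<pi> ! r" "\<pi> ! r < \<pi> ! q"
    then have "r = 0" "p = 1 \<or> p = 2" "q = 1 \<or> q = 2" using assms by auto
    with True *(5,6) show False by (elim disjE) simp_all
  qed (use assms in auto)
  then show ?thesis ..
next
  case False
  have "block \<pi> 0 2"
  proof (rule blockI)
    fix p q r
    assume *: "p \<in> {0..<2}" "q \<in> {0..<2}" "r < length \<pi>" "r \<notin> {0..<2}" "\<pi> ! p < \<pi> ! r" "\<pi> ! r < \<pi> ! q"
    then have "r = 2" "p = 0 \<or> p = 1" "q = 0 \<or> q = 1" using assms by auto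
    with False *(5,6) show False by (elim disjE) simp_all
  qed (use assms in auto)
  then show ?thesis ..
qed

text \<open>
  Cut at the positions that are interior to no proper block. The window between consecutive cut
  positions is a proper block: the largest proper block starting at the left one cannot end inside
  another proper block, as the union of the two would be a larger proper block, or else all of \<open>w\<close>,
  which by \<open>covering_blocks_cut\<close> would produce a cut. A block of the pattern with several but not all
  letters would be a proper block of \<open>w\<close> with a cut position in its interior, so there is none.
\<close>

lemma decomposition_along_maximal_blocks:
  assumes w: "is_perm w" and two: "2 \<le> length w"
    and no_cut: "\<And>R m. direction R \<Longrightarrow> \<not> cut R w m"
  shows "\<exists>\<pi> \<alpha>s. substitution_decomposition w \<pi> \<alpha>s"
proof -
  let ?n = "length w"
  have dist: "distinct w" using w by (simp add: is_perm_iff)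
  define proper where "proper a b \<longleftrightarrow> block w a b \<and> (a, b) \<noteq> (0, ?n)" for a b
  define M where "M = {m. m \<le> ?n \<and> (\<forall>a b. proper a b \<longrightarrow> \<not> (a < m \<and> m < b))}"
  have "0 \<in> M" "?n \<in> M" "M \<subseteq> {..?n}"
    by (auto simp: M_def proper_def dest: block_bounds)
  then obtain ns where ns: "\<And>x. x \<in> set ns \<Longrightarrow> 0 < x" "sum_list ns = ?n"
    and M: "M = offset ns ` {..length ns}"
    by (rule finite_set_as_offsets) blast
  let ?off = "offset ns"
  have less: "?off i < ?off j" if "i < j" "j \<le> length ns" for i j
    using offset_strict_mono that ns(1) by blast
  have offset_end: "?off (length ns) = ?n" by (simp add: ns(2))
  have not_interior: "\<not> (a < ?off i \<and> ?off i < b)" if "proper a b" "i \<le> length ns" for a b i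
    using M that by (auto simp: M_def)
  have maximal: "proper (?off i) (?off (Suc i))" if i: "i < length ns" for i
  proof -
    define a where "a = ?off i"
    \<comment> \<open>Singletons are proper blocks since \<open>w\<close> has at least two entries, so \<open>D\<close> is nonempty.\<close>
    define D where "D = {d. proper a d}"
    have a: "a < ?n" using less[of i "length ns"] i offset_end by (simp add: a_def)
    then have "block w a (Suc a)" by (auto simp: block_def)
    with two have "Suc a \<in> D" by (auto simp: D_def proper_def)
    have "finite D"
      by (rule finite_subset[of _ "{..?n}"]) (auto simp: D_def proper_def dest: block_bounds)
    define d where "d = Max D"
    have "d \<in> D" and d_max: "\<And>x. x \<in> D \<Longrightarrow> x \<le> d"
      using \<open>finite D\<close> \<open>Suc a \<in> D\<close> by (auto simp: d_def intro: Max_in)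
    then have d: "proper a d" "a < d" "d \<le> ?n"
      using block_bounds by (auto simp: D_def proper_def)
    have "d \<in> M"
    proof (rule ccontr)
      assume "d \<notin> M"
      then obtain e f where ef: "proper e f" "e < d" "d < f" using d by (auto simp: M_def)
      have f: "f \<le> ?n" using ef block_bounds by (auto simp: proper_def)
      have "a \<le> e"
        using not_interior[OF ef(1), of i] i ef d by (auto simp: a_def)
      then have af: "block w a f"
        using block_union[OF dist, of a d e f] d ef by (auto simp: proper_def)
      have "f \<notin> D" using d_max[of f] ef by auto
      with af have af_eq: "a = 0" "f = ?n" by (auto simp: D_def proper_def)
      with ef have "0 < e" by (cases e) (auto simp: proper_def)
      then have "\<exists>R. direction R \<and> cut R w d"
        using d ef f af_eq by (intro covering_blocks_cut[OF dist]) (auto simp: proper_def)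
      with no_cut show False by blast
    qed
    then obtain l where l: "l \<le> length ns" "d = ?off l" using M by auto
    have "i < l"
      by (rule ccontr) (use offset_mono[of l i ns] l d in \<open>auto simp: a_def\<close>)
    moreover have "\<not> Suc i < l"
      using not_interior[OF d(1), of "Suc i"] less[of "Suc i" l] less[of i "Suc i"] l i
      by (auto simp: a_def)
    ultimately have "l = Suc i" by simp
    with d(1) l show ?thesis by (simp add: a_def)
  qed
  have "ns \<noteq> []" using ns(2) two by auto
  moreover have "length ns \<noteq> 1"
  proof
    assume 1: "length ns = 1"
    have "proper (?off 0) (?off (Suc 0))" by (rule maximal) (simp add: 1)
    moreover have "?off (Suc 0) = ?n" using offset_end unfolding 1 by simp
    ultimately show False by (simp add: proper_def)
  qed
  ultimately have k2: "2 \<le> length ns" by (cases ns; cases "tl ns") auto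
  \<comment> \<open>One entry from each window represents the window in the pattern.\<close>
  define reps where "reps = map (\<lambda>i. w ! ?off i) [0..<length ns]"
  define \<pi> where "\<pi> = standardize reps"
  have off_n: "?off i < ?n" if "i < length ns" for i using less[of i "length ns"] that offset_end by simp
  have "distinct reps"
    unfolding distinct_conv_nth
  proof (intro allI impI)
    fix i j assume "i < length reps" "j < length reps" "i \<noteq> j"
    moreover from this have "?off i \<noteq> ?off j"
      using less[of i j] less[of j i] by (cases i j rule: linorder_cases) (auto simp: reps_def)
    ultimately show "reps ! i \<noteq> reps ! j"
      using dist off_n by (simp add: reps_def nth_eq_iff_index_eq)
  qed
  moreover have "reps \<noteq> []" using \<open>ns \<noteq> []\<close> by (simp add: reps_def)
  ultimately have \<pi>: "is_perm \<pi>" unfolding \<pi>_def by (intro is_perm_standardize)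
  have len: "length ns = length \<pi>" by (simp add: \<pi>_def reps_def)
  have \<pi>_less: "\<pi> ! i < \<pi> ! j \<longleftrightarrow> w ! ?off i < w ! ?off j" if "i < length ns" "j < length ns" for i j
    using that by (simp add: \<pi>_def standardize_less_iff reps_def)
  have across: "w ! (?off i + p) < w ! (?off j + q) \<longleftrightarrow> \<pi> ! i < \<pi> ! j"
    if "i < length ns" "j < length ns" "i \<noteq> j" "p < ns ! i" "q < ns ! j" for i j p q
  proof -
    have "{?off i..<?off (Suc i)} \<inter> {?off j..<?off (Suc j)} = {}"
      using offset_mono[of "Suc i" j ns] offset_mono[of "Suc j" i ns] that(3)
      by (cases i j rule: linorder_cases) auto
    note uniform = disjoint_blocks_uniform[OF dist _ _ this]
    have "block w (?off i) (?off (Suc i))" "block w (?off j) (?off (Suc j))"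
      using maximal that by (auto simp: proper_def)
    note uniform = uniform[OF this]
    have "?off i + p \<in> {?off i..<?off (Suc i)}" "?off i \<in> {?off i..<?off (Suc i)}"
      "?off j + q \<in> {?off j..<?off (Suc j)}" "?off j \<in> {?off j..<?off (Suc j)}"
      using that by (auto simp: offset_Suc)
    then show ?thesis
      using \<pi>_less[OF that(1,2)] uniform[of "?off i + p" "?off i" "?off j + q" "?off j"]
        uniform[of "?off i" "?off i + p" "?off j" "?off j + q"] by blast
  qed
  define \<alpha>s where "\<alpha>s = map (\<lambda>i. factor w (?off i) (ns ! i)) [0..<length ns]"
  have infl: "w = inflation \<pi> \<alpha>s"
    unfolding \<alpha>s_def by (rule eq_inflation_of_factors[OF w \<pi> ns(2) len ns(1) across])
  have perms: "\<And>\<alpha>. \<alpha> \<in> set \<alpha>s \<Longrightarrow> is_perm \<alpha>"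
    using factors_are_perms[OF w \<pi> ns(2) len ns(1) across] unfolding \<alpha>s_def by simp
  have lens: "map length \<alpha>s = ns"
    unfolding \<alpha>s_def by (rule length_factors[OF w \<pi> ns(2) len ns(1) across])
  have len': "length \<alpha>s = length \<pi>" by (simp add: \<alpha>s_def len)
  interpret inflated w \<pi> \<alpha>s
    unfolding infl by (rule inflation_inflated[OF \<pi> len' perms])
  have blocks: "j = Suc i \<or> i = 0 \<and> j = length \<pi>" if bl: "block \<pi> i j" for i j
  proof (rule ccontr)
    assume "\<not> ?thesis"
    moreover have ij: "i < j" "j \<le> length ns" using block_bounds[OF bl] len by auto
    ultimately have "Suc i < j" "0 < i \<or> j < length ns" using len by auto
    then have "(?off i, ?off j) \<noteq> (0, ?n)"
      using less[of 0 i] less[of j "length ns"] ij offset_end by auto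
    then have "proper (?off i) (?off j)"
      using block_of_pattern_block[OF bl] by (simp add: proper_def lens)
    from not_interior[OF this, of "Suc i"] show False
      using less[of i "Suc i"] less[of "Suc i" j] \<open>Suc i < j\<close> ij by simp
  qed
  have "length ns \<noteq> 2"
  proof
    assume "length ns = 2"
    then have "block w 0 (?off 1)" "block w (?off 1) ?n" "0 < ?off 1" "?off 1 < ?n"
      using maximal[of 0] maximal[of 1] offset_end less[of 0 1] less[of 1 2]
      by (auto simp: proper_def numeral_2_eq_2)
    then show False using covering_blocks_cut[OF dist, of "?off 1" "?off 1"] no_cut by blast
  qed
  moreover have "length ns \<noteq> 3"
  proof
    assume "length ns = 3"
    then have "block \<pi> 0 2 \<or> block \<pi> 1 3" using three_letters_not_simple len by simp
    then show False using blocks \<open>length ns = 3\<close> len by fastforce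
  qed
  ultimately have "simple_perm \<pi>"
    using \<pi> blocks k2 len by (intro simple_permI) auto
  then show ?thesis
    using infl perms len' by (auto simp: substitution_decomposition_def)
qed

lemma decomposition_tree_exists:
  "is_perm w \<Longrightarrow> \<exists>t. is_decomposition_tree w t"
proof (induction "length w" arbitrary: w rule: less_induct)
  case less
  show ?case
  proof (cases "2 \<le> length w")
    case False
    moreover have "length w \<noteq> 0" using less.prems by (simp add: is_perm_iff)
    ultimately have "length w = 1" by linarith
    then obtain x where "w = [x]" by (auto simp: length_Suc_conv)
    with less.prems have "w = [1]" by (simp add: is_perm_iff)
    then show ?thesis using is_decomposition_tree.leaf by blast
  next
    case True
    have "\<exists>\<pi> \<alpha>s. substitution_decomposition w \<pi> \<alpha>s"
      using decomposition_along_cuts[OF less.prems]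
        decomposition_along_maximal_blocks[OF less.prems True] by blast
    then obtain \<pi> \<alpha>s where dec: "substitution_decomposition w \<pi> \<alpha>s" by blast
    have infl: "inflated w \<pi> \<alpha>s" "2 \<le> length \<pi>" "\<forall>\<alpha> \<in> set \<alpha>s. is_perm \<alpha>"
      using dec by (cases rule: substitution_decomposition_cases; simp)+
    interpret inflated w \<pi> \<alpha>s by (rule infl)
    have "\<exists>t. is_decomposition_tree (\<alpha>s ! i) t" if i: "i < length \<pi>" for i
    proof (rule less.hyps)
      have "off i < off (Suc i)" "off (Suc i) \<le> length w" using i off_strict_mono off_le by auto
      moreover have "0 < off i \<or> off (Suc i) < length w"
        using off_strict_mono[of 0 i] off_strict_mono[of "Suc i" "length \<pi>"] off_end i infl(2)
        by (cases "i = 0") auto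
      ultimately show "length (\<alpha>s ! i) < length w" using off_Suc[OF i] by linarith
      show "is_perm (\<alpha>s ! i)" using infl(3) i length_parts by simp
    qed
    then obtain f where f: "\<And>i. i < length \<pi> \<Longrightarrow> is_decomposition_tree (\<alpha>s ! i) (f i)" by metis
    then have "list_all2 is_decomposition_tree \<alpha>s (map f [0..<length \<pi>])"
      by (auto simp: list_all2_conv_all_nth length_parts)
    with dec show ?thesis by (blast intro: is_decomposition_tree.node)
  qed
qed

section \<open>Generators of an interval poset\<close>

lemma is_decomposition_tree_decomposition_tree:
  assumes "is_perm w"
  shows "is_decomposition_tree w (decomposition_tree w)"
proof -
  from decomposition_tree_exists[OF assms] obtain t where "is_decomposition_tree w t" by blast
  then show ?thesis
    unfolding decomposition_tree_def by (rule theI) (erule decomposition_tree_unique, fact)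
qed

theorem proposition11:
  fixes P :: poset and \<sigma> \<tau> :: "nat list"
  assumes "is_interval_poset P"
    and "is_perm \<sigma>" and "interval_poset \<sigma> = P"
    and "is_perm \<tau>"
  shows "is_generator \<tau> P \<longleftrightarrow>
    skeleton (decomposition_tree (perm_inverse \<tau>)) = skeleton (decomposition_tree (perm_inverse \<sigma>))"
proof -
  have "is_generator \<tau> P \<longleftrightarrow> interval_poset \<tau> = interval_poset \<sigma>"
    using assms by (auto simp: is_generator_def)
  also have "\<dots> \<longleftrightarrow> block (perm_inverse \<tau>) = block (perm_inverse \<sigma>)"
    by (rule interval_poset_eq_iff[OF assms(4,2)])
  also have "\<dots> \<longleftrightarrow>
      skeleton (decomposition_tree (perm_inverse \<tau>)) = skeleton (decomposition_tree (perm_inverse \<sigma>))"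
    by (rule skeleton_eq_iff_block_eq[symmetric]; intro is_decomposition_tree_decomposition_tree
        is_perm_perm_inverse assms)
  finally show ?thesis .
qed

end
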